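(* Let $t\ge 2$ be an integer such that $r=\frac{1+\sqrt{8t-7}}{2}$ is an integer. If $\Gamma$ is a $t\mathcal{K}_{4}^{-}$-free unbalanced signed graph of sufficiently large order $n$, then \[ \lambda_1(\Gamma)\le \begin{cases} \lambda_1(\Gamma_{r,n}), & \text{if } 2\le t\le \binom{n-2}{2},\\[4pt] \lambda_1(\Gamma_{n-2,n}), & \text{if } t\ge \binom{n-2}{2}+1, \end{cases} \] with equality if and only if $\Gamma\sim\Gamma_{r,n}$ in the first case and $\Gamma\sim\Gamma_{n-2,n}$ in the second case.
   Context: A signed graph $\Gamma=(G,\sigma)$ consists of a simple graph $G$ (the underlying graph) and a sign function $\sigma:E(G)\to\{+1,-1\}$. Its adjacency matrix $A(\Gamma)=(a^\sigma_{ij})$ has $a^\sigma_{ij}=\sigma(v_iv_j)$ if $v_i v_j$ is an edge and $0$ otherwise; $\lambda_1(\Gamma)$ (the index) denotes the largest eigenvalue of $A(\Gamma)$. A cycle is positive if it has an even number of negative edges, negative otherwise; $\Gamma$ is balanced if all its cycles are positive, and unbalanced otherwise. A switching of $\Gamma$ with respect to a nonempty proper vertex subset $U$ reverses the signs of all edges between $U$ and its complement; $\Gamma\sim\Gamma'$ (switching equivalent) means $\Gamma'$ is obtained from $\Gamma$ by a finite sequence of switchings. Subgraphs of a signed graph inherit the signs of edges. Let $tK_4$ be the family of all graphs consisting of $t$ copies of $K_4$ that are allowed to share vertices, and $t\mathcal{K}_4^-$ the set of all unbalanced signed graphs whose underlying graph belongs to $tK_4$. A signed graph is $t\mathcal{K}_4^-$-free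 if it contains no subgraph isomorphic (as a signed graph) to a member of $t\mathcal{K}_4^-$. For $1\le s\le n-2$, $\Gamma_{s,n}$ is the signed graph obtained from the complete graph $K_{n-1}$ on $v_1,\dots,v_{n-1}$ (all edges positive) by adding a vertex $v_n$ adjacent exactly to $v_1,\dots,v_{s+1}$, where $v_nv_1$ is the unique negative edge. *)

theory Defs
  imports Complex_Main "Jordan_Normal_Form.Char_Poly"
begin

text \<open>An edge is a two-element set of vertices. The values of \<open>sig\<close> on sets that are not edges
  carry no information.\<close>

record 'a sgraph =
  verts :: "'a set"
  edges :: "'a set set"
  sig :: "'a set \<Rightarrow> int"

definition signed_graph :: "'a sgraph \<Rightarrow> bool" where
  "signed_graph \<Gamma> \<longleftrightarrow> finite (verts \<Gamma>)
     \<and> (\<forall>e\<in>edges \<Gamma>. e \<subseteq> verts \<Gamma> \<and> card e = 2 \<and> (sig \<Gamma> e = 1 \<or> sig \<Gamma> e = -1))"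

text \<open>The vertices are enumerated in increasing order; the spectrum does not depend on this.\<close>

definition adj_matrix :: "'a::linorder sgraph \<Rightarrow> real mat" where
  "adj_matrix \<Gamma> = (let vs = sorted_list_of_set (verts \<Gamma>); n = card (verts \<Gamma>) in
     mat n n (\<lambda>(i, j). if {vs ! i, vs ! j} \<in> edges \<Gamma>
                       then real_of_int (sig \<Gamma> {vs ! i, vs ! j}) else 0))"

definition lambda1 :: "'a::linorder sgraph \<Rightarrow> real" where
  "lambda1 \<Gamma> = Max {k. eigenvalue (adj_matrix \<Gamma>) k}"

text \<open>A cycle is given by the list of its vertices; its \<open>i\<close>-th edge joins the \<open>i\<close>-th vertex to the
  cyclically next one.\<close>

definition cycle_edge :: "'a list \<Rightarrow> nat \<Rightarrow> 'a set" where
  "cycle_edge vs i = {vs ! i, vs ! (Suc i mod length vs)}"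

definition is_cycle :: "'a sgraph \<Rightarrow> 'a list \<Rightarrow> bool" where
  "is_cycle \<Gamma> vs \<longleftrightarrow> 3 \<le> length vs \<and> distinct vs \<and> set vs \<subseteq> verts \<Gamma>
     \<and> (\<forall>i<length vs. cycle_edge vs i \<in> edges \<Gamma>)"

definition positive_cycle :: "'a sgraph \<Rightarrow> 'a list \<Rightarrow> bool" where
  "positive_cycle \<Gamma> vs \<longleftrightarrow> even (card {i. i < length vs \<and> sig \<Gamma> (cycle_edge vs i) = -1})"

definition balanced :: "'a sgraph \<Rightarrow> bool" where
  "balanced \<Gamma> \<longleftrightarrow> (\<forall>vs. is_cycle \<Gamma> vs \<longrightarrow> positive_cycle \<Gamma> vs)"

abbreviation unbalanced :: "'a sgraph \<Rightarrow> bool" where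
  "unbalanced \<Gamma> \<equiv> \<not> balanced \<Gamma>"

definition subgraph :: "'a sgraph \<Rightarrow> 'a sgraph \<Rightarrow> bool" where
  "subgraph H \<Gamma> \<longleftrightarrow> verts H \<subseteq> verts \<Gamma> \<and> edges H \<subseteq> edges \<Gamma>
     \<and> (\<forall>e\<in>edges H. sig H e = sig \<Gamma> e)"

definition induced :: "'a sgraph \<Rightarrow> 'a set \<Rightarrow> 'a sgraph" where
  "induced \<Gamma> X = \<Gamma>\<lparr>verts := X, edges := {e \<in> edges \<Gamma>. e \<subseteq> X}\<rparr>"

definition sg_iso :: "'a sgraph \<Rightarrow> 'b sgraph \<Rightarrow> bool" where
  "sg_iso \<Gamma> \<Gamma>' \<longleftrightarrow> (\<exists>f. bij_betw f (verts \<Gamma>) (verts \<Gamma>')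
     \<and> (\<forall>u\<in>verts \<Gamma>. \<forall>v\<in>verts \<Gamma>. {u, v} \<in> edges \<Gamma> \<longleftrightarrow> {f u, f v} \<in> edges \<Gamma>')
     \<and> (\<forall>u\<in>verts \<Gamma>. \<forall>v\<in>verts \<Gamma>. {u, v} \<in> edges \<Gamma> \<longrightarrow> sig \<Gamma> {u, v} = sig \<Gamma>' {f u, f v}))"

definition switching :: "'a set \<Rightarrow> 'a sgraph \<Rightarrow> 'a sgraph" where
  "switching U \<Gamma> = \<Gamma>\<lparr>sig := (\<lambda>e. if e \<inter> U \<noteq> {} \<and> e - U \<noteq> {} then - sig \<Gamma> e else sig \<Gamma> e)\<rparr>"

definition switch_step :: "'a sgraph \<Rightarrow> 'a sgraph \<Rightarrow> bool" where
  "switch_step \<Gamma> \<Gamma>' \<longleftrightarrow> (\<exists>U. U \<noteq> {} \<and> U \<subset> verts \<Gamma> \<and> \<Gamma>' = switching U \<Gamma>)"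

text \<open>Signed graphs are identified up to isomorphism here, so that an arbitrary signed graph can be
  switching equivalent to one with the labelled vertices \<open>1, \<dots>, n\<close>.\<close>

definition switching_equivalent :: "'a sgraph \<Rightarrow> 'b sgraph \<Rightarrow> bool" (infix "\<sim>\<^sub>s" 50) where
  "\<Gamma> \<sim>\<^sub>s \<Gamma>' \<longleftrightarrow> (\<exists>\<Delta>. switch_step\<^sup>*\<^sup>* \<Gamma> \<Delta> \<and> sg_iso \<Delta> \<Gamma>')"

text \<open>\<open>consists_of_K4s S H\<close>: the underlying graph of \<open>H\<close> is the union of the complete graphs on the
  four-element sets in \<open>S\<close>. These sets are distinct but may overlap in two or three vertices, i.e.
  copies of \<open>K\<^sub>4\<close> may share edges.\<close>

definition consists_of_K4s :: "'a set set \<Rightarrow> 'a sgraph \<Rightarrow> bool" where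
  "consists_of_K4s S H \<longleftrightarrow> (\<forall>X\<in>S. card X = 4) \<and> verts H = \<Union>S
     \<and> edges H = (\<Union>X\<in>S. {e. e \<subseteq> X \<and> card e = 2})"

text \<open>Each of the \<open>t\<close> copies of \<open>K\<^sub>4\<close> has to be unbalanced. Asking only that their union be unbalanced
  would rule out the extremal graph \<open>Gamma_sn r n\<close> below: it has exactly \<open>r choose 2 = t - 1\<close>
  unbalanced copies of \<open>K\<^sub>4\<close>, but one of them together with balanced copies of \<open>K\<^sub>4\<close> from
  \<open>K\<^sub>n\<^sub>-\<^sub>1\<close> is an unbalanced union of \<open>t\<close> copies. Freeness for that larger family, \<open>tK4_union\<close>, is the
  stronger condition (lemma \<open>tK4_minus_free_if_tK4_union_free\<close>).\<close>

definition tK4_minus :: "nat \<Rightarrow> 'a sgraph set" where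
  "tK4_minus t = {H. signed_graph H
     \<and> (\<exists>S. card S = t \<and> consists_of_K4s S H \<and> (\<forall>X\<in>S. unbalanced (induced H X)))}"

definition tK4_union :: "nat \<Rightarrow> 'a sgraph set" where
  "tK4_union t = {H. signed_graph H \<and> unbalanced H \<and> (\<exists>S. card S = t \<and> consists_of_K4s S H)}"

definition free_of :: "'a sgraph set \<Rightarrow> 'a sgraph \<Rightarrow> bool" where
  "free_of \<F> \<Gamma> \<longleftrightarrow> \<not> (\<exists>H. signed_graph H \<and> subgraph H \<Gamma> \<and> (\<exists>K\<in>\<F>. sg_iso H K))"

lemma unbalanced_if_induced_unbalanced:
  assumes "X \<subseteq> verts H" "unbalanced (induced H X)"
  shows "unbalanced H"
  using assms unfolding balanced_def is_cycle_def positive_cycle_def induced_def by fastforce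

lemma tK4_minus_subset_tK4_union:
  assumes "t \<ge> 1"
  shows "tK4_minus t \<subseteq> tK4_union t"
proof
  fix H :: "'a sgraph"
  assume "H \<in> tK4_minus t"
  then obtain S where S: "signed_graph H" "card S = t" "consists_of_K4s S H"
    "\<forall>X\<in>S. unbalanced (induced H X)" unfolding tK4_minus_def by blast
  then obtain X where X: "X \<in> S" using assms by (metis card.empty ex_in_conv not_one_le_zero)
  then have "X \<subseteq> verts H" using S unfolding consists_of_K4s_def by blast
  then have "unbalanced H" using S X unbalanced_if_induced_unbalanced by blast
  then show "H \<in> tK4_union t" using S unfolding tK4_union_def by blast
qed

lemma tK4_minus_free_if_tK4_union_free:
  assumes "t \<ge> 1" "free_of (tK4_union t) \<Gamma>"
  shows "free_of (tK4_minus t) \<Gamma>"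
  using assms tK4_minus_subset_tK4_union[OF assms(1)] unfolding free_of_def by blast

text \<open>The graph \<open>\<Gamma>\<^sub>s\<^sub>,\<^sub>n\<close>, meant for \<open>1 \<le> s \<le> n - 2\<close>; vertex \<open>v\<^sub>i\<close> is the number \<open>i\<close>.\<close>

definition Gamma_sn :: "nat \<Rightarrow> nat \<Rightarrow> nat sgraph" where
  "Gamma_sn s n = \<lparr>verts = {1..n},
     edges = {e. e \<subseteq> {1..n-1} \<and> card e = 2} \<union> {{n, i} |i. 1 \<le> i \<and> i \<le> s + 1},
     sig = (\<lambda>e. if e = {n, 1} then -1 else 1)\<rparr>"

end

theory Submission
  imports Defs "HOL-Analysis.Function_Topology" "HOL-Analysis.Convex"
begin

text \<open>Switch \<open>\<Gamma>\<close> so that a unit eigenvector \<open>x\<close> for \<open>\<lambda>\<^sub>1\<close> is nonnegative, and let \<open>uv\<close> be a negative edge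
  with \<open>x\<^sub>u \<le> x\<^sub>v\<close>. Compared with \<open>(\<Sum>x)\<^sup>2 - \<Sum>x\<^sup>2\<close>, the form \<open>x\<^sup>T A x\<close> loses \<open>2 x\<^sub>i x\<^sub>j\<close> for every missing and
  \<open>4 x\<^sub>i x\<^sub>j\<close> for every negative edge. A vertex that is not a common positive neighbour of \<open>u\<close> and \<open>v\<close>
  costs at least as much as a non-neighbour of \<open>u\<close>. The common positive neighbours span at most
  \<open>r choose 2\<close> edges, so as long as more than \<open>r\<close> of them are left, one of them, \<open>w\<close>, misses edges to two
  others, \<open>p\<close> and \<open>q\<close>. If \<open>\<lambda>\<^sub>1 \<ge> n - 2\<close>, at most one entry of \<open>x\<close> can be small and \<open>x\<^sub>p + x\<^sub>q > x\<^sub>u\<close>, so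
  these two missing edges cost more than the single edge \<open>uw\<close>, and \<open>w\<close> can be removed. Hence \<open>\<Gamma>\<close> loses at
  least as much as \<open>\<Gamma>\<^sub>r\<^sub>,\<^sub>n\<close>, placed with \<open>v\<^sub>n = u\<close> and \<open>v\<^sub>1 = v\<close>. The second case is \<open>r = n - 2\<close>, where the
  bound on the number of edges holds trivially.\<close>

subsection \<open>Quadratic forms and the largest eigenvalue\<close>

definition qform :: "'a set \<Rightarrow> ('a \<Rightarrow> 'a \<Rightarrow> real) \<Rightarrow> ('a \<Rightarrow> real) \<Rightarrow> real" where
  "qform V a x = (\<Sum>i\<in>V. \<Sum>j\<in>V. a i j * x i * x j)"

definition adj :: "'a sgraph \<Rightarrow> 'a \<Rightarrow> 'a \<Rightarrow> real" where
  "adj \<Gamma> i j = (if {i, j} \<in> edges \<Gamma> then real_of_int (sig \<Gamma> {i, j}) else 0)"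

lemma adj_sym: "adj \<Gamma> i j = adj \<Gamma> j i"
  by (simp add: adj_def insert_commute)

lemma qform_cong:
  assumes "\<And>i j. i \<in> V \<Longrightarrow> j \<in> V \<Longrightarrow> a i j = b i j" "\<And>i. i \<in> V \<Longrightarrow> x i = y i"
  shows "qform V a x = qform V b y"
  unfolding qform_def using assms by (auto intro!: sum.cong)

lemma qform_scale: "qform V a (\<lambda>i. c * x i) = c\<^sup>2 * qform V a x"
  unfolding qform_def by (simp add: sum_distrib_left power2_eq_square algebra_simps)

lemma qform_reindex:
  assumes "bij_betw g V V'"
  shows "qform V (\<lambda>i j. b (g i) (g j)) (\<lambda>i. x (g i)) = qform V' b x"
proof -
  have "(\<Sum>i\<in>V. \<Sum>j\<in>V. b (g i) (g j) * x (g i) * x (g j))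
      = (\<Sum>i\<in>V. \<Sum>j\<in>V'. b (g i) j * x (g i) * x j)"
    by (rule sum.cong[OF refl], rule sum.reindex_bij_betw[OF assms])
  also have "\<dots> = (\<Sum>i\<in>V'. \<Sum>j\<in>V'. b i j * x i * x j)"
    by (rule sum.reindex_bij_betw[OF assms])
  finally show ?thesis unfolding qform_def .
qed

text \<open>The unit sphere in the coordinates from \<open>V\<close> is compact and the form is
  continuous, so a maximum exists there; homogeneity of degree two extends the bound to every
  \<open>y\<close>.\<close>

lemma qform_max_attained:
  fixes a :: "'a \<Rightarrow> 'a \<Rightarrow> real"
  assumes fin: "finite V" and ne: "V \<noteq> {}"
  shows "\<exists>x. (\<Sum>i\<in>V. (x i)\<^sup>2) = 1 \<and> (\<forall>y. qform V a y \<le> qform V a x * (\<Sum>i\<in>V. (y i)\<^sup>2))"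
proof -
  \<comment> \<open>Coordinates outside \<open>V\<close> are frozen at 0, so that the sphere becomes
    a closed part of a product of compact sets, although the functions live on the whole type.
    \<open>qform\<close> ignores these coordinates.\<close>
  define B where "B = (PiE UNIV (\<lambda>i. if i \<in> V then {-1..1} else {0}) :: ('a \<Rightarrow> real) set)"
  define K where "K = B \<inter> {x. (\<Sum>i\<in>V. (x i)\<^sup>2) = 1}"
  have "compactin (product_topology (\<lambda>i. euclidean) UNIV) B"
    unfolding B_def compactin_PiE by auto
  then have cB: "compact B" by (simp add: euclidean_product_topology)
  have cont: "continuous_on A (\<lambda>x. x i)" for A and i :: 'a
    by (rule continuous_on_subset[OF continuous_on_product_coordinates]) simp
  have "closed {x. (\<Sum>i\<in>V. (x i)\<^sup>2) = (1::real)}"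
    by (intro closed_Collect_eq continuous_intros cont)
  with cB have cK: "compact K" unfolding K_def by (rule compact_Int_closed)
  from ne obtain k where k: "k \<in> V" by auto
  have "(\<Sum>i\<in>V. ((if i = k then 1 else 0)\<^sup>2 :: real)) = (\<Sum>i\<in>V. if i = k then 1 else 0)"
    by (rule sum.cong) auto
  also have "\<dots> = 1" using fin k by simp
  finally have "(\<lambda>i. if i = k then 1 else 0) \<in> K" using k unfolding K_def B_def by auto
  then have neK: "K \<noteq> {}" by auto
  have "continuous_on K (qform V a)"
    unfolding qform_def by (intro continuous_intros cont)
  from continuous_attains_sup[OF cK neK this] obtain x where
    x: "x \<in> K" "\<And>y. y \<in> K \<Longrightarrow> qform V a y \<le> qform V a x" by auto
  have "qform V a y \<le> qform V a x * (\<Sum>i\<in>V. (y i)\<^sup>2)" for y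
  proof (cases "(\<Sum>i\<in>V. (y i)\<^sup>2) = 0")
    case True
    then have "\<forall>i\<in>V. y i = 0" using fin by (subst (asm) sum_nonneg_eq_0_iff) auto
    then have "qform V a y = 0" unfolding qform_def by simp
    then show ?thesis using True by simp
  next
    case False
    define S where "S = (\<Sum>i\<in>V. (y i)\<^sup>2)"
    have S: "S > 0" using False sum_nonneg[of V "\<lambda>i. (y i)\<^sup>2"] unfolding S_def by force
    define z where "z = (\<lambda>i. if i \<in> V then inverse (sqrt S) * y i else 0)"
    have "(\<Sum>i\<in>V. (z i)\<^sup>2) = (\<Sum>i\<in>V. inverse S * (y i)\<^sup>2)"
      using S by (intro sum.cong) (auto simp: z_def power_mult_distrib power_inverse)
    then have z1: "(\<Sum>i\<in>V. (z i)\<^sup>2) = 1"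
      using S by (simp add: sum_distrib_left[symmetric] S_def)
    have "\<bar>z i\<bar> \<le> 1" if "i \<in> V" for i
    proof -
      have "(z i)\<^sup>2 \<le> (\<Sum>i\<in>V. (z i)\<^sup>2)" using fin that by (intro member_le_sum) auto
      then show ?thesis using z1 by (simp add: abs_square_le_1)
    qed
    then have "z \<in> K" unfolding K_def B_def using z1 by (auto simp: z_def abs_le_iff)
    then have "qform V a z \<le> qform V a x" by (rule x(2))
    also have "qform V a z = qform V a (\<lambda>i. inverse (sqrt S) * y i)"
      by (rule qform_cong) (auto simp: z_def)
    also have "\<dots> = inverse S * qform V a y"
      using S by (simp add: qform_scale power_inverse)
    finally show ?thesis using S by (simp add: field_simps S_def)
  qed
  then show ?thesis using x(1) unfolding K_def by auto
qed

lemma qform_eigen: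
  assumes "\<And>i. i \<in> V \<Longrightarrow> (\<Sum>j\<in>V. a i j * x j) = k * x i"
  shows "qform V a x = k * (\<Sum>i\<in>V. (x i)\<^sup>2)"
proof -
  have "qform V a x = (\<Sum>i\<in>V. x i * (\<Sum>j\<in>V. a i j * x j))"
    unfolding qform_def by (simp add: sum_distrib_left algebra_simps)
  also have "\<dots> = (\<Sum>i\<in>V. k * (x i)\<^sup>2)"
    using assms by (intro sum.cong) (auto simp: power2_eq_square)
  finally show ?thesis by (simp add: sum_distrib_left)
qed

text \<open>First variation: moving the maximizer \<open>x\<close> by \<open>t\<close> along
  coordinate \<open>k\<close> changes \<open>qform\<close> minus \<open>\<mu>\<close> times the
  squared norm by \<open>2 * t * d + t\<^sup>2 * c\<close>, where \<open>d\<close> is the error in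
  row \<open>k\<close> of the eigenvalue equation. This stays nonpositive for all \<open>t\<close>
  only if \<open>d = 0\<close>.\<close>

lemma qform_max_eigen:
  fixes a :: "'a \<Rightarrow> 'a \<Rightarrow> real"
  assumes fin: "finite V" and sym: "\<And>i j. a i j = a j i"
    and max: "\<And>y. qform V a y \<le> \<mu> * (\<Sum>i\<in>V. (y i)\<^sup>2)"
    and x: "qform V a x = \<mu> * (\<Sum>i\<in>V. (x i)\<^sup>2)" and k: "k \<in> V"
  shows "(\<Sum>j\<in>V. a k j * x j) = \<mu> * x k"
proof -
  define c where "c = a k k - \<mu>"
  define d where "d = (\<Sum>j\<in>V. a k j * x j) - \<mu> * x k"
  let ?e = "\<lambda>i. if i = k then 1 else (0::real)"
  have ineq: "2 * t * d + t\<^sup>2 * c \<le> 0" for t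
  proof -
    let ?y = "\<lambda>i. x i + t * ?e i"
    have "qform V a ?y = (\<Sum>i\<in>V. (\<Sum>j\<in>V. a i j * x i * x j) + t * x i * (\<Sum>j\<in>V. a i j * ?e j)
        + t * ?e i * (\<Sum>j\<in>V. a i j * x j) + t\<^sup>2 * ?e i * (\<Sum>j\<in>V. a i j * ?e j))"
      unfolding qform_def sum_distrib_left sum.distrib[symmetric]
      by (intro sum.cong) (auto simp: algebra_simps power2_eq_square)
    also have "\<dots> = (\<Sum>i\<in>V. (\<Sum>j\<in>V. a i j * x i * x j) + t * (a i k * x i)
        + (if i = k then t * (\<Sum>j\<in>V. a i j * x j) + t\<^sup>2 * a i k else 0))"
      using fin k by (intro sum.cong) (auto simp: if_distrib cong: if_cong)
    also have "\<dots> = qform V a x + t * (\<Sum>i\<in>V. a i k * x i) + (t * (\<Sum>j\<in>V. a k j * x j) + t\<^sup>2 * a k k)"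
      using fin k by (simp add: sum.distrib qform_def sum_distrib_left)
    also have "(\<Sum>i\<in>V. a i k * x i) = (\<Sum>j\<in>V. a k j * x j)" by (simp add: sym[of _ k])
    finally have q: "qform V a ?y = qform V a x + 2 * t * (\<Sum>j\<in>V. a k j * x j) + t\<^sup>2 * a k k"
      by simp
    have "(\<Sum>i\<in>V. (?y i)\<^sup>2) = (\<Sum>i\<in>V. (x i)\<^sup>2 + (if i = k then 2 * t * x i + t\<^sup>2 else 0))"
      by (intro sum.cong) (auto simp: algebra_simps power2_eq_square)
    also have "\<dots> = (\<Sum>i\<in>V. (x i)\<^sup>2) + 2 * t * x k + t\<^sup>2"
      using fin k by (simp add: sum.distrib)
    finally have n: "(\<Sum>i\<in>V. (?y i)\<^sup>2) = (\<Sum>i\<in>V. (x i)\<^sup>2) + 2 * t * x k + t\<^sup>2" .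
    show ?thesis using max[of ?y] unfolding q n x c_def d_def by (simp add: algebra_simps)
  qed
  \<comment> \<open>Testing \<open>t = d / (1 + \<bar>c\<bar>)\<close> works for either sign of
    \<open>c\<close>, zero included: the resulting value is \<open>d\<^sup>2\<close> times a
    positive factor.\<close>
  have p: "1 + \<bar>c\<bar> > 0" by linarith
  have "2 * (d / (1 + \<bar>c\<bar>)) * d + (d / (1 + \<bar>c\<bar>))\<^sup>2 * c = d\<^sup>2 * (2 * (1 + \<bar>c\<bar>) + c) / (1 + \<bar>c\<bar>)\<^sup>2"
    using p by (simp add: divide_simps power2_eq_square) (simp add: algebra_simps)
  then have "d\<^sup>2 * (2 * (1 + \<bar>c\<bar>) + c) / (1 + \<bar>c\<bar>)\<^sup>2 \<le> 0"
    using ineq[of "d / (1 + \<bar>c\<bar>)"] by simp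
  then have "d\<^sup>2 * (2 * (1 + \<bar>c\<bar>) + c) \<le> 0" using p by (simp add: divide_le_0_iff)
  moreover have "2 * (1 + \<bar>c\<bar>) + c > 0" by (cases "c \<ge> 0") auto
  ultimately have "d\<^sup>2 \<le> 0" by (simp add: mult_le_0_iff)
  then show ?thesis unfolding d_def by simp
qed

lemma eigenvalue_adj_matrix:
  fixes \<Gamma> :: "'a::linorder sgraph"
  assumes fin: "finite (verts \<Gamma>)"
  shows "eigenvalue (adj_matrix \<Gamma>) k \<longleftrightarrow>
    (\<exists>x. (\<exists>i\<in>verts \<Gamma>. x i \<noteq> 0) \<and> (\<forall>i\<in>verts \<Gamma>. (\<Sum>j\<in>verts \<Gamma>. adj \<Gamma> i j * x j) = k * x i))"
proof -
  define vs where "vs = sorted_list_of_set (verts \<Gamma>)"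
  define n where "n = card (verts \<Gamma>)"
  have vs: "distinct vs" "set vs = verts \<Gamma>" "length vs = n"
    using fin unfolding vs_def n_def by auto
  have bij: "bij_betw (\<lambda>i. vs ! i) {..<n} (verts \<Gamma>)"
    using bij_betw_nth[OF vs(1)] vs by auto
  have A: "adj_matrix \<Gamma> = mat n n (\<lambda>(i, j). adj \<Gamma> (vs ! i) (vs ! j))"
    unfolding adj_matrix_def adj_def Let_def vs_def n_def by simp
  have mv: "(adj_matrix \<Gamma> *\<^sub>v v) $ i = (\<Sum>j<n. adj \<Gamma> (vs ! i) (vs ! j) * v $ j)"
    if "i < n" "v \<in> carrier_vec n" for i v
    using that unfolding A by (simp add: scalar_prod_def atLeast0LessThan)
  show ?thesis
  proof
    assume "eigenvalue (adj_matrix \<Gamma>) k"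
    then obtain v where v: "v \<in> carrier_vec n" "v \<noteq> 0\<^sub>v n" "adj_matrix \<Gamma> *\<^sub>v v = k \<cdot>\<^sub>v v"
      unfolding eigenvalue_def eigenvector_def by (auto simp: A)
    define x where "x = (\<lambda>u. v $ (the_inv_into {..<n} (\<lambda>i. vs ! i) u))"
    have x: "x (vs ! i) = v $ i" if "i < n" for i
      using the_inv_into_f_f[OF bij_betw_imp_inj_on[OF bij], of i] that by (simp add: x_def)
    from v(1,2) obtain i where i: "i < n" "v $ i \<noteq> 0"
      by (metis eq_vecI carrier_vecD index_zero_vec)
    have "vs ! i \<in> verts \<Gamma>" "x (vs ! i) \<noteq> 0" using i x vs by auto
    moreover have "(\<Sum>j\<in>verts \<Gamma>. adj \<Gamma> u j * x j) = k * x u" if "u \<in> verts \<Gamma>" for u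
    proof -
      from that vs obtain l where l: "l < n" "u = vs ! l" by (metis in_set_conv_nth)
      have "(\<Sum>j\<in>verts \<Gamma>. adj \<Gamma> u j * x j) = (\<Sum>j<n. adj \<Gamma> u (vs ! j) * x (vs ! j))"
        by (rule sum.reindex_bij_betw[OF bij, symmetric])
      also have "\<dots> = (\<Sum>j<n. adj \<Gamma> (vs ! l) (vs ! j) * v $ j)" using x l by simp
      also have "\<dots> = k * v $ l" using mv[OF l(1) v(1)] v l by simp
      finally show ?thesis using x l by simp
    qed
    ultimately show "\<exists>x. (\<exists>i\<in>verts \<Gamma>. x i \<noteq> 0)
        \<and> (\<forall>i\<in>verts \<Gamma>. (\<Sum>j\<in>verts \<Gamma>. adj \<Gamma> i j * x j) = k * x i)" by blast
  next
    assume "\<exists>x. (\<exists>i\<in>verts \<Gamma>. x i \<noteq> 0)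
        \<and> (\<forall>i\<in>verts \<Gamma>. (\<Sum>j\<in>verts \<Gamma>. adj \<Gamma> i j * x j) = k * x i)"
    then obtain x u where x: "u \<in> verts \<Gamma>" "x u \<noteq> 0"
      "\<And>i. i \<in> verts \<Gamma> \<Longrightarrow> (\<Sum>j\<in>verts \<Gamma>. adj \<Gamma> i j * x j) = k * x i" by blast
    define v where "v = vec n (\<lambda>i. x (vs ! i))"
    have v: "v \<in> carrier_vec n" unfolding v_def by simp
    from x(1) vs obtain l where l: "l < n" "u = vs ! l" by (metis in_set_conv_nth)
    then have "v $ l \<noteq> 0" using x by (simp add: v_def)
    then have nz: "v \<noteq> 0\<^sub>v n" using l by auto
    have "adj_matrix \<Gamma> *\<^sub>v v = k \<cdot>\<^sub>v v"
    proof (rule eq_vecI)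
      fix i assume "i < dim_vec (k \<cdot>\<^sub>v v)"
      then have i: "i < n" using v by simp
      have "(adj_matrix \<Gamma> *\<^sub>v v) $ i = (\<Sum>j<n. adj \<Gamma> (vs ! i) (vs ! j) * x (vs ! j))"
        using mv[OF i v] by (simp add: v_def)
      also have "\<dots> = (\<Sum>j\<in>verts \<Gamma>. adj \<Gamma> (vs ! i) j * x j)"
        by (rule sum.reindex_bij_betw[OF bij])
      also have "\<dots> = k * x (vs ! i)" using x(3)[of "vs ! i"] nth_mem[of i vs] vs i by simp
      finally show "(adj_matrix \<Gamma> *\<^sub>v v) $ i = (k \<cdot>\<^sub>v v) $ i" using i by (simp add: v_def)
    qed (simp add: A v_def)
    then show "eigenvalue (adj_matrix \<Gamma>) k"
      unfolding eigenvalue_def eigenvector_def using v nz by (auto simp: A)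
  qed
qed

text \<open>\<open>Max\<close> needs a finite set, and eigenvalues are roots of the nonzero
  characteristic polynomial. Each eigenvalue is the Rayleigh quotient of its eigenvector, hence at
  most \<open>\<mu>\<close>, and the maximizer \<open>x\<close> makes \<open>\<mu>\<close> itself an
  eigenvalue.\<close>

lemma lambda1_eqI:
  fixes \<Gamma> :: "'a::linorder sgraph"
  assumes fin: "finite (verts \<Gamma>)"
    and max: "\<And>y. qform (verts \<Gamma>) (adj \<Gamma>) y \<le> \<mu> * (\<Sum>i\<in>verts \<Gamma>. (y i)\<^sup>2)"
    and x: "qform (verts \<Gamma>) (adj \<Gamma>) x = \<mu>" "(\<Sum>i\<in>verts \<Gamma>. (x i)\<^sup>2) = 1"
  shows "lambda1 \<Gamma> = \<mu>"
  unfolding lambda1_def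
proof (rule Max_eqI)
  let ?n = "card (verts \<Gamma>)"
  have A: "adj_matrix \<Gamma> \<in> carrier_mat ?n ?n" unfolding adj_matrix_def Let_def by simp
  have "char_poly (adj_matrix \<Gamma>) \<noteq> 0" using degree_monic_char_poly[OF A] by auto
  then show "finite {k. eigenvalue (adj_matrix \<Gamma>) k}"
    unfolding eigenvalue_root_char_poly[OF A] by (rule poly_roots_finite)
next
  fix k assume "k \<in> {k. eigenvalue (adj_matrix \<Gamma>) k}"
  then obtain y u where y: "u \<in> verts \<Gamma>" "y u \<noteq> 0"
    "\<And>i. i \<in> verts \<Gamma> \<Longrightarrow> (\<Sum>j\<in>verts \<Gamma>. adj \<Gamma> i j * y j) = k * y i"
    unfolding mem_Collect_eq eigenvalue_adj_matrix[OF fin] by blast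
  have "k * (\<Sum>i\<in>verts \<Gamma>. (y i)\<^sup>2) \<le> \<mu> * (\<Sum>i\<in>verts \<Gamma>. (y i)\<^sup>2)"
    using max[of y] qform_eigen[OF y(3)] by simp
  moreover have "(\<Sum>i\<in>verts \<Gamma>. (y i)\<^sup>2) > 0"
    using y fin by (intro sum_pos2[of _ u]) auto
  ultimately show "k \<le> \<mu>" by simp
next
  have "(\<Sum>j\<in>verts \<Gamma>. adj \<Gamma> k j * x j) = \<mu> * x k" if "k \<in> verts \<Gamma>" for k
    by (rule qform_max_eigen[OF fin adj_sym max _ that]) (simp add: x)
  moreover have "\<exists>i\<in>verts \<Gamma>. x i \<noteq> 0" using x(2) by (rule_tac ccontr) simp
  ultimately show "\<mu> \<in> {k. eigenvalue (adj_matrix \<Gamma>) k}"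
    unfolding mem_Collect_eq eigenvalue_adj_matrix[OF fin] by blast
qed

lemma lambda1_attained:
  fixes \<Gamma> :: "'a::linorder sgraph"
  assumes fin: "finite (verts \<Gamma>)" and ne: "verts \<Gamma> \<noteq> {}"
  shows "\<exists>x. (\<Sum>i\<in>verts \<Gamma>. (x i)\<^sup>2) = 1 \<and> qform (verts \<Gamma>) (adj \<Gamma>) x = lambda1 \<Gamma>
    \<and> (\<forall>y. qform (verts \<Gamma>) (adj \<Gamma>) y \<le> lambda1 \<Gamma> * (\<Sum>i\<in>verts \<Gamma>. (y i)\<^sup>2))"
proof -
  obtain x where x: "(\<Sum>i\<in>verts \<Gamma>. (x i)\<^sup>2) = 1"
    "\<And>y. qform (verts \<Gamma>) (adj \<Gamma>) y \<le> qform (verts \<Gamma>) (adj \<Gamma>) x * (\<Sum>i\<in>verts \<Gamma>. (y i)\<^sup>2)"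
    using qform_max_attained[OF fin ne, of "adj \<Gamma>"] by blast
  have "lambda1 \<Gamma> = qform (verts \<Gamma>) (adj \<Gamma>) x"
    by (rule lambda1_eqI[OF fin x(2) refl x(1)])
  then show ?thesis using x by auto
qed

text \<open>The two matrices are conjugate by a signed permutation: \<open>g\<close> relabels the
  vertices and \<open>f\<close> is the sign diagonal of a switching. Substituting
  \<open>f i * y (g i)\<close> preserves both the form and the norm.\<close>

lemma lambda1_eq_if_qform_eq:
  fixes \<Gamma> :: "'a::linorder sgraph" and \<Gamma>' :: "'b::linorder sgraph"
  assumes fin: "finite (verts \<Gamma>)" and ne: "verts \<Gamma> \<noteq> {}"
    and g: "bij_betw g (verts \<Gamma>) (verts \<Gamma>')"
    and f: "\<And>i. i \<in> verts \<Gamma> \<Longrightarrow> f i = 1 \<or> f i = (-1::real)"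
    and eq: "\<And>i j. i \<in> verts \<Gamma> \<Longrightarrow> j \<in> verts \<Gamma> \<Longrightarrow> adj \<Gamma> i j = f i * f j * adj \<Gamma>' (g i) (g j)"
  shows "lambda1 \<Gamma> = lambda1 \<Gamma>'"
proof -
  have fin': "finite (verts \<Gamma>')" using g fin bij_betw_finite by blast
  have ne': "verts \<Gamma>' \<noteq> {}" using g ne by (auto simp: bij_betw_def)
  have f2: "f i * f i = 1" if "i \<in> verts \<Gamma>" for i using f[OF that] by auto
  have q: "qform (verts \<Gamma>) (adj \<Gamma>) (\<lambda>i. f i * y (g i)) = qform (verts \<Gamma>') (adj \<Gamma>') y" for y
  proof -
    have "qform (verts \<Gamma>) (adj \<Gamma>) (\<lambda>i. f i * y (g i))
        = qform (verts \<Gamma>) (\<lambda>i j. adj \<Gamma>' (g i) (g j)) (\<lambda>i. y (g i))"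
      unfolding qform_def
    proof (intro sum.cong refl)
      fix i j assume i: "i \<in> verts \<Gamma>" and j: "j \<in> verts \<Gamma>"
      have "adj \<Gamma> i j * (f i * y (g i)) * (f j * y (g j))
          = (f i * f i) * (f j * f j) * (adj \<Gamma>' (g i) (g j) * y (g i) * y (g j))"
        unfolding eq[OF i j] by (simp add: algebra_simps)
      then show "adj \<Gamma> i j * (f i * y (g i)) * (f j * y (g j)) = adj \<Gamma>' (g i) (g j) * y (g i) * y (g j)"
        using f2 i j by simp
    qed
    then show ?thesis by (simp add: qform_reindex[OF g])
  qed
  have n: "(\<Sum>i\<in>verts \<Gamma>. (f i * y (g i))\<^sup>2) = (\<Sum>i\<in>verts \<Gamma>'. (y i)\<^sup>2)" for y
  proof -
    have "(\<Sum>i\<in>verts \<Gamma>. (f i * y (g i))\<^sup>2) = (\<Sum>i\<in>verts \<Gamma>. (y (g i))\<^sup>2)"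
      using f2 by (intro sum.cong) (auto simp: power_mult_distrib power2_eq_square)
    then show ?thesis using sum.reindex_bij_betw[OF g, of "\<lambda>i. (y i)\<^sup>2"] by simp
  qed
  obtain x where x: "(\<Sum>i\<in>verts \<Gamma>. (x i)\<^sup>2) = 1" "qform (verts \<Gamma>) (adj \<Gamma>) x = lambda1 \<Gamma>"
    "\<And>y. qform (verts \<Gamma>) (adj \<Gamma>) y \<le> lambda1 \<Gamma> * (\<Sum>i\<in>verts \<Gamma>. (y i)\<^sup>2)"
    using lambda1_attained[OF fin ne] by blast
  define h where "h = the_inv_into (verts \<Gamma>) g"
  define y where "y = (\<lambda>u. f (h u) * x (h u))"
  have xy: "f i * y (g i) = x i" if "i \<in> verts \<Gamma>" for i
    using f2[OF that] the_inv_into_f_f[OF bij_betw_imp_inj_on[OF g] that]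
    by (simp add: y_def h_def mult.assoc[symmetric])
  show ?thesis
  proof (rule lambda1_eqI[symmetric, OF fin'])
    show "qform (verts \<Gamma>') (adj \<Gamma>') z \<le> lambda1 \<Gamma> * (\<Sum>i\<in>verts \<Gamma>'. (z i)\<^sup>2)" for z
      using x(3)[of "\<lambda>i. f i * z (g i)"] unfolding q n .
    show "qform (verts \<Gamma>') (adj \<Gamma>') y = lambda1 \<Gamma>"
      unfolding q[symmetric] x(2)[symmetric] by (rule qform_cong) (auto simp: xy)
    show "(\<Sum>i\<in>verts \<Gamma>'. (y i)\<^sup>2) = 1"
      unfolding n[symmetric] x(1)[symmetric] by (rule sum.cong) (auto simp: xy)
  qed
qed

subsection \<open>Nonnegative eigenvectors\<close>

lemma qform_split:
  assumes fin: "finite V" and P: "P \<subseteq> V" and sym: "\<And>i j. a i j = a j i"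
  shows "qform V a x = qform P a x + 2 * (\<Sum>i\<in>P. \<Sum>j\<in>V - P. a i j * x i * x j) + qform (V - P) a x"
proof -
  let ?f = "\<lambda>i j. a i j * x i * x j"
  have V: "(\<Sum>i\<in>V. g i) = (\<Sum>i\<in>P. g i) + (\<Sum>i\<in>V - P. g i)" for g :: "'a \<Rightarrow> real"
    using sum.subset_diff[OF P fin, of g] by simp
  have "qform V a x = (\<Sum>i\<in>P. \<Sum>j\<in>P. ?f i j) + (\<Sum>i\<in>P. \<Sum>j\<in>V - P. ?f i j)
      + ((\<Sum>i\<in>V - P. \<Sum>j\<in>P. ?f i j) + (\<Sum>i\<in>V - P. \<Sum>j\<in>V - P. ?f i j))"
    unfolding qform_def by (simp add: V sum.distrib)
  also have "(\<Sum>i\<in>V - P. \<Sum>j\<in>P. ?f i j) = (\<Sum>i\<in>P. \<Sum>j\<in>V - P. ?f i j)"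
    by (subst sum.swap) (intro sum.cong refl, simp add: sym algebra_simps)
  finally show ?thesis unfolding qform_def by simp
qed

lemma qform_pair:
  assumes "p \<noteq> q" "\<And>i. a i i = 0" "\<And>i j. a i j = a j i"
  shows "qform {p, q} a x = 2 * a p q * x p * x q"
  using assms unfolding qform_def by simp

lemma qform_mono_set:
  assumes "finite V" "C \<subseteq> V" "\<And>i j. i \<in> V \<Longrightarrow> j \<in> V \<Longrightarrow> 0 \<le> a i j" "\<And>i. i \<in> V \<Longrightarrow> 0 \<le> x i"
  shows "qform C a x \<le> qform V a x"
proof -
  have "qform C a x \<le> (\<Sum>i\<in>C. \<Sum>j\<in>V. a i j * x i * x j)"
    unfolding qform_def using assms by (intro sum_mono sum_mono2) auto
  also have "\<dots> \<le> qform V a x"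
    unfolding qform_def using assms by (intro sum_mono2 sum_nonneg) auto
  finally show ?thesis .
qed

text \<open>Loss against the complete graph with all signs positive: 0 for a positive edge, 1 for a
  missing edge, 2 for a negative one.\<close>

definition deficit :: "('a \<Rightarrow> 'a \<Rightarrow> real) \<Rightarrow> 'a \<Rightarrow> 'a \<Rightarrow> real" where
  "deficit a i j = (if i = j then 0 else 1 - a i j)"

lemma sum_deficit:
  assumes "finite V" "i \<in> V" "a i i = 0"
  shows "(\<Sum>j\<in>V. a i j * x j) = (\<Sum>j\<in>V. x j) - x i - (\<Sum>j\<in>V. deficit a i j * x j)"
proof -
  have "(\<Sum>j\<in>V. a i j * x j) = (\<Sum>j\<in>V. x j - (if j = i then x j else 0) - deficit a i j * x j)"
    using assms(3) by (intro sum.cong) (auto simp: deficit_def algebra_simps)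
  also have "\<dots> = (\<Sum>j\<in>V. x j) - (\<Sum>j\<in>V. if j = i then x j else 0) - (\<Sum>j\<in>V. deficit a i j * x j)"
    by (simp add: sum_subtractf)
  finally show ?thesis using assms by simp
qed

lemma qform_deficit:
  assumes "finite V" "\<And>i. i \<in> V \<Longrightarrow> a i i = 0"
  shows "qform V a x = (\<Sum>i\<in>V. x i)\<^sup>2 - (\<Sum>i\<in>V. (x i)\<^sup>2) - qform V (deficit a) x"
proof -
  have "qform V a x = (\<Sum>i\<in>V. x i * (\<Sum>j\<in>V. a i j * x j))"
    unfolding qform_def by (simp add: sum_distrib_left algebra_simps)
  also have "\<dots> = (\<Sum>i\<in>V. x i * (\<Sum>j\<in>V. x j) - (x i)\<^sup>2 - x i * (\<Sum>j\<in>V. deficit a i j * x j))"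
    by (intro sum.cong refl, subst sum_deficit) (use assms in \<open>auto simp: algebra_simps power2_eq_square\<close>)
  also have "\<dots> = (\<Sum>i\<in>V. x i * (\<Sum>j\<in>V. x j)) - (\<Sum>i\<in>V. (x i)\<^sup>2) - (\<Sum>i\<in>V. x i * (\<Sum>j\<in>V. deficit a i j * x j))"
    by (simp add: sum_subtractf)
  also have "(\<Sum>i\<in>V. x i * (\<Sum>j\<in>V. deficit a i j * x j)) = qform V (deficit a) x"
    unfolding qform_def by (simp add: sum_distrib_left algebra_simps)
  also have "(\<Sum>i\<in>V. x i * (\<Sum>j\<in>V. x j)) = (\<Sum>i\<in>V. x i)\<^sup>2"
    by (simp add: sum_distrib_right power2_eq_square)
  finally show ?thesis .
qed

section \<open>Edges spanned by a vertex set\<close>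

definition pair_edges :: "('a \<Rightarrow> 'a \<Rightarrow> bool) \<Rightarrow> 'a set \<Rightarrow> 'a set set" where
  "pair_edges E C = {e. \<exists>i\<in>C. \<exists>j\<in>C. e = {i, j} \<and> i \<noteq> j \<and> E i j}"

lemma finite_pair_edges: "finite C \<Longrightarrow> finite (pair_edges E C)"
  by (rule finite_subset[of _ "Pow C"]) (auto simp: pair_edges_def)

lemma pair_edges_mono: "C \<subseteq> C' \<Longrightarrow> pair_edges E C \<subseteq> pair_edges E C'"
  unfolding pair_edges_def by blast

lemma two_mult_choose_two: "2 * (n choose 2) = n * (n - 1)"
proof -
  have "even (n * (n - 1))" by (cases n) auto
  then show ?thesis unfolding choose_two by (rule dvd_mult_div_cancel)
qed

text \<open>Otherwise every vertex of \<open>C\<close> has degree at least \<open>card C - 2\<close>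
  within \<open>C\<close>. Double counting gives \<open>card C * (card C - 2) \<le> r * (r - 1)
  \<le> (card C - 1) * (card C - 2)\<close>, which is impossible for
  \<open>card C \<ge> 3\<close>.\<close>

lemma two_nonneighbours:
  assumes fin: "finite C" and r: "2 \<le> r" "r < card C"
    and few: "card (pair_edges E C) \<le> r choose 2"
  shows "\<exists>w\<in>C. \<exists>p\<in>C. \<exists>q\<in>C. p \<noteq> q \<and> p \<noteq> w \<and> q \<noteq> w \<and> \<not> E w p \<and> \<not> E w q"
proof (rule ccontr)
  assume no: "\<not> ?thesis"
  let ?F = "pair_edges E C"
  have deg: "card C - 2 \<le> card {e \<in> ?F. w \<in> e}" if w: "w \<in> C" for w
  proof -
    let ?M = "{p \<in> C. p \<noteq> w \<and> \<not> E w p}"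
    have fM: "finite ?M" using fin by simp
    have "card ?M \<le> 1"
      unfolding card_le_Suc0_iff_eq[OF fM, folded One_nat_def] using no w by blast
    have "C - {w} - ?M \<subseteq> {p \<in> C. p \<noteq> w \<and> E w p}" by auto
    then have "card (C - {w} - ?M) \<le> card {p \<in> C. p \<noteq> w \<and> E w p}"
      using fin by (intro card_mono) auto
    moreover have "card (C - {w} - ?M) \<ge> card (C - {w}) - card ?M"
      using fM by (rule diff_card_le_card_Diff)
    moreover have "card (C - {w}) = card C - 1" using w fin by simp
    moreover have "card {p \<in> C. p \<noteq> w \<and> E w p} = card ((\<lambda>p. {w, p}) ` {p \<in> C. p \<noteq> w \<and> E w p})"
      by (intro card_image[symmetric]) (auto simp: inj_on_def doubleton_eq_iff)
    moreover have "\<dots> \<le> card {e \<in> ?F. w \<in> e}"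
      using w finite_pair_edges[OF fin] by (intro card_mono) (auto simp: pair_edges_def)
    ultimately show ?thesis using \<open>card ?M \<le> 1\<close> by linarith
  qed
  have "card C * (card C - 2) \<le> (\<Sum>w\<in>C. card {e \<in> ?F. w \<in> e})"
    using sum_mono[OF deg] by simp
  also have "\<dots> = 2 * card ?F"
  proof (rule sum_multicount)
    show "\<forall>e\<in>?F. card {w \<in> C. w \<in> e} = 2"
    proof
      fix e assume "e \<in> ?F"
      then obtain i j where ij: "i \<in> C" "j \<in> C" "e = {i, j}" "i \<noteq> j" unfolding pair_edges_def by auto
      then have "{w \<in> C. w \<in> e} = {i, j}" by auto
      then show "card {w \<in> C. w \<in> e} = 2" using ij by simp
    qed
  qed (use fin finite_pair_edges in auto)
  also have "\<dots> \<le> 2 * (r choose 2)" using few by simp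
  also have "\<dots> = r * (r - 1)" by (rule two_mult_choose_two)
  also have "\<dots> \<le> (card C - 1) * (card C - 2)" using r by (intro mult_mono) auto
  also have "\<dots> < card C * (card C - 2)" using r by (intro mult_strict_right_mono) auto
  finally show False by simp
qed

text \<open>The adjacency matrix of \<Gamma>_{r,n} on arbitrary vertex names, when \<open>W\<close>
  has size \<open>r\<close> and avoids \<open>u\<close> and \<open>v\<close>: \<open>u\<close> plays
  v_n, \<open>v\<close> plays v_1, and \<open>W\<close> holds the positive neighbours of v_n. It can
  thus be compared with the matrix of \<Gamma> entry by entry.\<close>

definition star_matrix :: "'a \<Rightarrow> 'a \<Rightarrow> 'a set \<Rightarrow> 'a \<Rightarrow> 'a \<Rightarrow> real" where
  "star_matrix u v W i j = (if i = j then 0 else if {i, j} = {u, v} then -1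
    else if (i = u \<and> j \<notin> W) \<or> (j = u \<and> i \<notin> W) then 0 else 1)"

text \<open>The situation after switching: \<open>x\<close> is a nonnegative unit eigenvector of the
  switched matrix \<open>a\<close>, and \<open>u\<close> is the end with the smaller entry of a
  negative edge. The lower bound on \<open>l\<close> comes from the positive K_{n-1} inside
  \<Gamma>_{r,n}.\<close>

locale nonneg_eigenvector =
  fixes V :: "'a set" and a :: "'a \<Rightarrow> 'a \<Rightarrow> real" and x :: "'a \<Rightarrow> real" and l :: real and u v :: 'a
  assumes fin: "finite V" and large: "20 \<le> card V"
    and sym: "a i j = a j i" and diag: "a i i = 0" and vals: "a i j \<in> {-1, 0, 1}"
    and nonneg: "i \<in> V \<Longrightarrow> 0 \<le> x i" and unit: "(\<Sum>i\<in>V. (x i)\<^sup>2) = 1"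
    and eigen: "i \<in> V \<Longrightarrow> (\<Sum>j\<in>V. a i j * x j) = l * x i"
    and l_ge: "real (card V) - 2 \<le> l"
    and uv: "u \<in> V" "v \<in> V" "u \<noteq> v" "a u v = -1" "x u \<le> x v"
begin

section \<open>Bounds on the entries of the eigenvector\<close>

abbreviation n :: real where "n \<equiv> real (card V)"

lemma n_ge: "20 \<le> n" using large by simp

lemma a_le_1: "a i j \<le> 1" using vals[of i j] by auto

lemma a_ge: "-1 \<le> a i j" using vals[of i j] by auto

lemma qform_unit: "qform V a x = l"
  using qform_eigen[of V a x l] eigen unit by simp

text \<open>Entries are at most 1 and the diagonal vanishes, so the form is at most the square of
  the sum minus the sum of squares; Cauchy-Schwarz yields the factor \<open>card T - 1\<close>. The
  edge \<open>uv\<close> counts -1 instead of 1, which takes off \<open>2 * x u * x v\<close> for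
  each of its two orders.\<close>

lemma qform_subset_le:
  assumes T: "T \<subseteq> V"
  shows "qform T a x \<le> (real (card T) - 1) * (\<Sum>i\<in>T. (x i)\<^sup>2)
    - (if u \<in> T \<and> v \<in> T then 4 * x u * x v else 0)"
proof -
  have finT: "finite T" using T fin by (rule finite_subset)
  let ?d = "\<lambda>i j. if i = j then (x i)\<^sup>2 else 0"
  let ?e = "\<lambda>u v i j. if i = u then if j = v then 2 * x u * x v else 0 else 0"
  have "a i j * x i * x j \<le> x i * x j - ?d i j - ?e u v i j - ?e v u i j" if "i \<in> T" "j \<in> T" for i j
  proof -
    have p: "0 \<le> x i * x j" using that T by (intro mult_nonneg_nonneg nonneg) auto
    have "a i j * (x i * x j) \<le> 1 * (x i * x j)" using p a_le_1 by (intro mult_right_mono) auto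
    then show ?thesis
      using uv(3,4) diag sym[of v u] by (auto simp: power2_eq_square)
  qed
  then have "qform T a x \<le> (\<Sum>i\<in>T. \<Sum>j\<in>T. x i * x j - ?d i j - ?e u v i j - ?e v u i j)"
    unfolding qform_def by (intro sum_mono) auto
  also have "\<dots> = (\<Sum>i\<in>T. x i)\<^sup>2 - (\<Sum>i\<in>T. \<Sum>j\<in>T. ?d i j)
      - (\<Sum>i\<in>T. \<Sum>j\<in>T. ?e u v i j) - (\<Sum>i\<in>T. \<Sum>j\<in>T. ?e v u i j)"
    by (simp only: sum_subtractf) (simp add: power2_eq_square sum_product)
  also have "(\<Sum>i\<in>T. \<Sum>j\<in>T. ?d i j) = (\<Sum>i\<in>T. (x i)\<^sup>2)" using finT by simp
  also have e: "(\<Sum>i\<in>T. \<Sum>j\<in>T. ?e p q i j) = (if p \<in> T \<and> q \<in> T then 2 * x p * x q else 0)" for p q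
  proof -
    have "(\<Sum>i\<in>T. \<Sum>j\<in>T. ?e p q i j)
        = (\<Sum>i\<in>T. if i = p then (if q \<in> T then 2 * x p * x q else 0) else 0)"
      using finT by (intro sum.cong) auto
    then show ?thesis using finT by auto
  qed
  finally have "qform T a x \<le> (\<Sum>i\<in>T. x i)\<^sup>2 - (\<Sum>i\<in>T. (x i)\<^sup>2)
      - (if u \<in> T \<and> v \<in> T then 4 * x u * x v else 0)"
    unfolding e by (auto split: if_splits)
  moreover have "(\<Sum>i\<in>T. x i)\<^sup>2 \<le> (\<Sum>i\<in>T. (x i)\<^sup>2) * real (card T)"
    by (rule sum_squared_le_sum_of_squares)
  ultimately show ?thesis by (simp add: algebra_simps)
qed

lemma l_le: "l \<le> n - 1"
proof -
  have "l \<le> n - 1 - 4 * x u * x v"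
    using qform_subset_le[OF subset_refl] uv unfolding qform_unit unit by simp
  moreover have "0 \<le> x u * x v" using nonneg uv by simp
  ultimately show ?thesis by simp
qed

lemma sum_x_sq_le: "(\<Sum>i\<in>V. x i)\<^sup>2 \<le> n"
  using sum_squared_le_sum_of_squares[of x V] unit by simp

text \<open>Row \<open>i\<close> of the eigenvalue equation bounds \<open>(l + 1) * x i\<close> by
  the sum of all entries, whose square is at most \<open>n\<close>.\<close>

lemma x_sq_le:
  assumes i: "i \<in> V"
  shows "(x i)\<^sup>2 * (n - 1)\<^sup>2 \<le> n"
proof -
  have "l * x i = (\<Sum>j\<in>V. a i j * x j)" using eigen i by simp
  also have "\<dots> \<le> (\<Sum>j\<in>V. x j - (if j = i then x j else 0))"
  proof (rule sum_mono)
    fix j assume j: "j \<in> V"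
    then have "a i j * x j \<le> 1 * x j" using nonneg a_le_1 by (intro mult_right_mono) auto
    then show "a i j * x j \<le> x j - (if j = i then x j else 0)" using diag by auto
  qed
  also have "\<dots> = (\<Sum>j\<in>V. x j) - x i" using i fin by (simp add: sum_subtractf)
  finally have "(l + 1) * x i \<le> (\<Sum>j\<in>V. x j)" by (simp add: algebra_simps)
  moreover have "(n - 1) * x i \<le> (l + 1) * x i" using l_ge nonneg i by (intro mult_right_mono) auto
  ultimately have "(n - 1) * x i \<le> (\<Sum>j\<in>V. x j)" by simp
  then have "((n - 1) * x i)\<^sup>2 \<le> (\<Sum>j\<in>V. x j)\<^sup>2"
    using nonneg[OF i] n_ge by (intro power_mono) auto
  then show ?thesis using sum_x_sq_le by (simp add: power_mult_distrib mult.commute)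
qed

text \<open>The cross terms between \<open>R\<close> and the rest are not estimated: the eigenvalue
  equation on the rows of \<open>R\<close> gives them exactly in terms of \<open>l\<close> and the
  form on \<open>R\<close>.\<close>

lemma qform_remove:
  assumes R: "R \<subseteq> V"
  shows "qform (V - R) a x = l * (1 - 2 * (\<Sum>i\<in>R. (x i)\<^sup>2)) + qform R a x"
proof -
  have "(\<Sum>i\<in>R. \<Sum>j\<in>V - R. a i j * x i * x j)
      = (\<Sum>i\<in>R. x i * (\<Sum>j\<in>V. a i j * x j) - (\<Sum>j\<in>R. a i j * x i * x j))"
  proof (rule sum.cong[OF refl])
    fix i
    have "(\<Sum>j\<in>V. a i j * x i * x j) = (\<Sum>j\<in>V - R. a i j * x i * x j) + (\<Sum>j\<in>R. a i j * x i * x j)"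
      by (rule sum.subset_diff[OF R fin])
    moreover have "(\<Sum>j\<in>V. a i j * x i * x j) = x i * (\<Sum>j\<in>V. a i j * x j)"
      by (simp add: sum_distrib_left algebra_simps)
    ultimately show "(\<Sum>j\<in>V - R. a i j * x i * x j)
        = x i * (\<Sum>j\<in>V. a i j * x j) - (\<Sum>j\<in>R. a i j * x i * x j)" by simp
  qed
  also have "\<dots> = (\<Sum>i\<in>R. x i * (\<Sum>j\<in>V. a i j * x j)) - qform R a x"
    by (simp add: sum_subtractf qform_def)
  also have "(\<Sum>i\<in>R. x i * (\<Sum>j\<in>V. a i j * x j)) = (\<Sum>i\<in>R. l * (x i)\<^sup>2)"
    using R eigen by (intro sum.cong) (auto simp: power2_eq_square)
  also have "\<dots> = l * (\<Sum>i\<in>R. (x i)\<^sup>2)" by (simp add: sum_distrib_left)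
  finally have "(\<Sum>i\<in>R. \<Sum>j\<in>V - R. a i j * x i * x j) = l * (\<Sum>i\<in>R. (x i)\<^sup>2) - qform R a x" .
  moreover have "l = qform R a x + 2 * (\<Sum>i\<in>R. \<Sum>j\<in>V - R. a i j * x i * x j) + qform (V - R) a x"
    using qform_split[OF fin R, of a x, OF sym] unfolding qform_unit .
  ultimately show ?thesis by (simp add: right_diff_distrib)
qed

lemma sum_sq_remove:
  assumes "R \<subseteq> V"
  shows "(\<Sum>i\<in>V - R. (x i)\<^sup>2) = 1 - (\<Sum>i\<in>R. (x i)\<^sup>2)"
  using sum.subset_diff[OF assms fin, of "\<lambda>i. (x i)\<^sup>2"] unit by simp

text \<open>If both entries were small, deleting \<open>p\<close> and \<open>q\<close> would hardly
  change the form; but \<open>n - 2\<close> vertices support at most \<open>n - 3\<close> times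
  their squared norm, and \<open>l \<ge> n - 2\<close>. Hence at most one entry can have a square
  below \<open>1 / (2 * (n + 2))\<close>.\<close>

lemma pair_sq_ge:
  assumes pq: "p \<in> V" "q \<in> V" "p \<noteq> q"
  shows "1 / (n + 2) \<le> (x p)\<^sup>2 + (x q)\<^sup>2"
proof -
  let ?R = "{p, q}" and ?s = "(x p)\<^sup>2 + (x q)\<^sup>2"
  have R: "?R \<subseteq> V" using pq by auto
  have "real (card (V - ?R)) = n - 2"
    using pq R fin card_mono[OF fin R] by (simp add: card_Diff_subset)
  moreover have "(\<Sum>i\<in>?R. (x i)\<^sup>2) = ?s" using pq by simp
  moreover have "0 \<le> x u * x v" using nonneg uv by simp
  ultimately have "l * (1 - 2 * ?s) + qform ?R a x \<le> (n - 3) * (1 - ?s)"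
    using qform_subset_le[of "V - ?R"] unfolding qform_remove[OF R] sum_sq_remove[OF R]
    by (auto split: if_splits)
  moreover have "- ?s \<le> qform ?R a x"
  proof -
    have "2 * (x p * x q) \<le> ?s" using sum_squares_bound[of "x p" "x q"] by (simp add: mult.assoc)
    moreover have "-1 * (x p * x q) \<le> a p q * (x p * x q)"
      using a_ge nonneg pq by (intro mult_right_mono) auto
    ultimately show ?thesis using qform_pair[OF pq(3), of a x, OF diag sym] by (simp add: mult.assoc)
  qed
  ultimately have 1: "l * (1 - 2 * ?s) - ?s \<le> (n - 3) * (1 - ?s)" by linarith
  then have "l - (n - 3) \<le> ?s * (2 * l + 4 - n)" by (simp add: algebra_simps)
  also have "\<dots> \<le> ?s * (n + 2)" using l_le by (intro mult_left_mono) auto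
  finally have "1 \<le> ?s * (n + 2)" using l_ge by linarith
  then show ?thesis using n_ge by (simp add: field_simps)
qed

text \<open>Deleting \<open>z\<close> leaves the edge \<open>uv\<close> in place, and its loss of
  \<open>4 * x u * x v\<close> has to be made up by the weight of \<open>z\<close>. In contrast to
  \<open>pair_sq_ge\<close>, this controls a single entry.\<close>

lemma third_sq_ge:
  assumes z: "z \<in> V" "z \<noteq> u" "z \<noteq> v"
  shows "4 * (x u * x v) \<le> (n - 2) * (x z)\<^sup>2"
proof -
  have R: "{z} \<subseteq> V" using z by auto
  have c: "real (card (V - {z})) = n - 1"
    using z fin large by (simp add: card_Diff_singleton_if)
  have "qform {z} a x = 0" by (simp add: qform_def diag)
  then have 1: "l * (1 - 2 * (x z)\<^sup>2) \<le> (n - 2) * (1 - (x z)\<^sup>2) - 4 * (x u * x v)"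
    using qform_subset_le[of "V - {z}"] uv z c unfolding qform_remove[OF R] sum_sq_remove[OF R]
    by simp
  have "2 * n \<le> (n - 1)\<^sup>2"
  proof -
    have "0 \<le> (n - 4) * n + 1" using n_ge by (intro add_nonneg_nonneg mult_nonneg_nonneg) auto
    then show ?thesis by (simp add: power2_eq_square algebra_simps)
  qed
  then have "(x z)\<^sup>2 * (2 * n) \<le> n"
    using x_sq_le[OF z(1)] mult_left_mono[of "2 * n" "(n - 1)\<^sup>2" "(x z)\<^sup>2"] by simp
  then have "n * (2 * (x z)\<^sup>2) \<le> n * 1" by (simp add: algebra_simps)
  then have "2 * (x z)\<^sup>2 \<le> 1" using n_ge by (subst (asm) mult_le_cancel_left) auto
  then have "(n - 2) * (1 - 2 * (x z)\<^sup>2) \<le> l * (1 - 2 * (x z)\<^sup>2)"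
    using l_ge by (intro mult_right_mono) auto
  with 1 show ?thesis by (simp add: algebra_simps)
qed

text \<open>The final contradiction of \<open>pair_sum_gt_aux\<close> with denominators cleared. In
  terms of \<open>m = n - 1\<close> the sign of the difference can be read off.\<close>

lemma four_power_bound: "(4 * n - 1)\<^sup>2 * (n - 2) < 4 * (n - 1) ^ 4"
proof -
  define m where "m = n - 1"
  have m: "m \<ge> 19" "n = m + 1" using n_ge unfolding m_def by auto
  have "4 * 2 \<le> m * (m - 4)" using m by (intro mult_mono) auto
  then have "0 \<le> 4 * m\<^sup>2 * (m * (m - 4) - 2)" by (intro mult_nonneg_nonneg) auto
  moreover have "4 * m ^ 4 - (4 * m + 3)\<^sup>2 * (m - 1) = 4 * m\<^sup>2 * (m * (m - 4) - 2) + 15 * m + 9"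
    by (simp add: power2_eq_square power4_eq_xxxx algebra_simps)
  ultimately have "(4 * m + 3)\<^sup>2 * (m - 1) < 4 * m ^ 4" using m by linarith
  moreover have "4 * n - 1 = 4 * m + 3" "n - 2 = m - 1" "n - 1 = m" using m by auto
  ultimately show ?thesis by metis
qed

text \<open>If the sum were at most \<open>x u\<close>, the product \<open>x p * x q\<close> would
  be squeezed. From below: \<open>x u\<close> and \<open>x q\<close> are large by
  \<open>pair_sq_ge\<close>, so \<open>third_sq_ge\<close> keeps \<open>x p\<close> away from 0, and
  the product has order at least n^(-3/2). From above: the square of the sum is at most
  \<open>n / (n - 1)\<^sup>2\<close>, of which the two squares already take
  \<open>1 / (n + 2)\<close>, leaving only order n^(-2).\<close>

lemma pair_sum_gt_aux:
  assumes pq: "p \<in> V" "q \<in> V" "p \<noteq> q" "p \<notin> {u, v}" and le: "x p \<le> x q"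
  shows "x u < x p + x q"
proof (rule ccontr)
  assume "\<not> ?thesis"
  then have pu: "x p + x q \<le> x u" by simp
  define h where "h = 1 / (n + 2)"
  have n2: "n + 2 > 0" "n - 2 > 0" "n - 1 > 0" using n_ge by auto
  have h: "h > 0" using n2 by (simp add: h_def)
  have pV: "0 \<le> x p" "0 \<le> x q" "0 \<le> x u" using pq nonneg uv by auto
  \<comment> \<open>The pair bound is applied to \<open>p\<close> and \<open>u\<close> as well; as
    \<open>x p \<le> x u\<close>, at least half of \<open>h\<close> falls on
    \<open>u\<close>.\<close>
  have "(x p)\<^sup>2 \<le> (x u)\<^sup>2" using pV pu by (intro power_mono) auto
  moreover have "h \<le> (x p)\<^sup>2 + (x u)\<^sup>2" unfolding h_def using pq uv by (intro pair_sq_ge) auto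
  ultimately have 1: "h / 2 \<le> (x u)\<^sup>2" by simp
  have "(x u)\<^sup>2 \<le> x u * x v" using uv(5) pV by (simp add: power2_eq_square mult_left_mono)
  then have "4 * (h / 2) \<le> (n - 2) * (x p)\<^sup>2" using third_sq_ge[of p] pq 1 by simp
  then have 2: "2 * h / (n - 2) \<le> (x p)\<^sup>2" using n2 by (simp add: field_simps)
  have "(x p)\<^sup>2 \<le> (x q)\<^sup>2" using pV le by (intro power_mono) auto
  moreover have h3: "h \<le> (x p)\<^sup>2 + (x q)\<^sup>2" unfolding h_def using pq by (intro pair_sq_ge) auto
  ultimately have 3: "h / 2 \<le> (x q)\<^sup>2" by simp
  have "2 * h / (n - 2) * (h / 2) \<le> (x p)\<^sup>2 * (x q)\<^sup>2"
    using 2 3 h n2 by (intro mult_mono) auto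
  then have 4: "h\<^sup>2 / (n - 2) \<le> (x p * x q)\<^sup>2" by (simp add: power2_eq_square algebra_simps)
  have "(x p + x q)\<^sup>2 \<le> (x u)\<^sup>2" using pV pu by (intro power_mono) auto
  then have "(x p)\<^sup>2 + (x q)\<^sup>2 + 2 * (x p * x q) \<le> (x u)\<^sup>2" by (simp add: power2_sum)
  then have "h + 2 * (x p * x q) \<le> (x u)\<^sup>2" using h3 by linarith
  also have "(x u)\<^sup>2 \<le> n / (n - 1)\<^sup>2" using x_sq_le[OF uv(1)] n2 by (simp add: field_simps)
  finally have "2 * (x p * x q) \<le> n / (n - 1)\<^sup>2 - h" by simp
  also have "\<dots> = h * ((4 * n - 1) / (n - 1)\<^sup>2)"
  proof -
    have "n * (n + 2) - (n - 1)\<^sup>2 = 4 * n - 1" by (simp add: power2_eq_square algebra_simps)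
    then show ?thesis using n2 unfolding h_def
      by (simp add: diff_frac_eq mult.commute)
  qed
  finally have "(2 * (x p * x q))\<^sup>2 \<le> (h * ((4 * n - 1) / (n - 1)\<^sup>2))\<^sup>2"
    using pV by (intro power_mono) auto
  then have "4 * (x p * x q)\<^sup>2 \<le> h\<^sup>2 * ((4 * n - 1)\<^sup>2 / (n - 1) ^ 4)"
    by (simp add: power_mult_distrib power_divide power_mult[symmetric])
  moreover have "h\<^sup>2 * (4 / (n - 2)) = 4 * (h\<^sup>2 / (n - 2))" by simp
  ultimately have "h\<^sup>2 * (4 / (n - 2)) \<le> h\<^sup>2 * ((4 * n - 1)\<^sup>2 / (n - 1) ^ 4)" using 4 by linarith
  then have "4 / (n - 2) \<le> (4 * n - 1)\<^sup>2 / (n - 1) ^ 4"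
    by (rule mult_left_le_imp_le) (use h in simp)
  then have "4 * (n - 1) ^ 4 \<le> (4 * n - 1)\<^sup>2 * (n - 2)" using n2 by (simp add: divide_simps)
  then show False using four_power_bound by simp
qed

lemma pair_sum_gt:
  assumes "p \<in> V" "q \<in> V" "p \<noteq> q" "p \<notin> {u, v}" "q \<notin> {u, v}"
  shows "x u < x p + x q"
  using pair_sum_gt_aux[of p q] pair_sum_gt_aux[of q p] assms by (cases "x p \<le> x q") auto

section \<open>Pruning the common neighbours\<close>

abbreviation d :: "'a \<Rightarrow> 'a \<Rightarrow> real" where "d \<equiv> deficit a"

lemma d_sym: "d i j = d j i"
  by (simp add: deficit_def sym[of i j])

lemma d_nonneg: "0 \<le> d i j"
  using a_le_1 by (simp add: deficit_def)

text \<open>Vertices are removed one by one. While more than \<open>r\<close> are left, some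
  \<open>w\<close> misses edges to some \<open>p\<close> and \<open>q\<close>, a loss of
  \<open>2 * x w * (x p + x q)\<close>. By \<open>pair_sum_gt\<close> this covers
  \<open>2 * x w * x u\<close>, the price in the star matrix of keeping \<open>w\<close> out of
  \<open>W\<close>. The strict clause serves the equality case: with positive entries a single
  removal already gives a strict gain.\<close>

lemma prune_common_neighbours:
  assumes r: "2 \<le> r" and C: "C \<subseteq> V - {u, v}"
    and few: "card (pair_edges (\<lambda>i j. a i j \<noteq> 0) C) \<le> r choose 2"
  shows "\<exists>W\<subseteq>C. card W \<le> r \<and> 2 * x u * (\<Sum>i\<in>C - W. x i) \<le> qform C d x
    \<and> (W \<noteq> C \<longrightarrow> (\<forall>i\<in>C. 0 < x i) \<longrightarrow> 2 * x u * (\<Sum>i\<in>C - W. x i) < qform C d x)"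
  using C few
proof (induction "card C" arbitrary: C rule: less_induct)
  case less
  have finC: "finite C" using less.prems(1) fin finite_subset by auto
  show ?case
  proof (cases "card C \<le> r")
    case True
    have "0 \<le> qform C d x"
      unfolding qform_def using less.prems(1) d_nonneg nonneg
      by (intro sum_nonneg mult_nonneg_nonneg) auto
    then show ?thesis using True by (intro exI[of _ C]) auto
  next
    case False
    then have "r < card C" by simp
    from two_nonneighbours[OF finC r this less.prems(2)]
    obtain w p q where wpq: "w \<in> C" "p \<in> C" "q \<in> C" "p \<noteq> q" "p \<noteq> w" "q \<noteq> w"
      "a w p = 0" "a w q = 0" by blast
    let ?C = "C - {w}"
    have "card (pair_edges (\<lambda>i j. a i j \<noteq> 0) ?C) \<le> r choose 2"
      using less.prems(2) card_mono[OF finite_pair_edges[OF finC] pair_edges_mono[of ?C C]]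
      by (meson Diff_subset le_trans)
    moreover have "card ?C < card C" using card_Diff1_less[OF finC wpq(1)] .
    ultimately obtain W where W: "W \<subseteq> ?C" "card W \<le> r"
      "2 * x u * (\<Sum>i\<in>?C - W. x i) \<le> qform ?C d x"
      using less.hyps[of ?C] less.prems(1) by blast
    have inV: "i \<in> V" if "i \<in> C" for i using that less.prems(1) by auto
    have "(\<Sum>j\<in>{p, q}. d w j * x w * x j) \<le> (\<Sum>j\<in>?C. d w j * x w * x j)"
      using wpq finC inV d_nonneg nonneg by (intro sum_mono2 mult_nonneg_nonneg) auto
    moreover have "(\<Sum>j\<in>{p, q}. d w j * x w * x j) = x w * (x p + x q)"
      using wpq by (simp add: deficit_def algebra_simps)
    moreover have "qform C d x
        = qform {w} d x + 2 * (\<Sum>j\<in>?C. d w j * x w * x j) + qform ?C d x"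
      using qform_split[OF finC, of "{w}" d x, OF _ d_sym] wpq by simp
    moreover have "qform {w} d x = 0" by (simp add: qform_def deficit_def)
    ultimately have q: "2 * (x w * (x p + x q)) + qform ?C d x \<le> qform C d x" by linarith
    have gt: "x u < x p + x q" using wpq less.prems(1) by (intro pair_sum_gt) auto
    have "C - W = insert w (?C - W)" using W wpq by auto
    then have s: "2 * x u * (\<Sum>i\<in>C - W. x i) = 2 * (x w * x u) + 2 * x u * (\<Sum>i\<in>?C - W. x i)"
      using finC by (simp add: algebra_simps)
    have "x w * x u \<le> x w * (x p + x q)"
      using gt nonneg inV wpq by (intro mult_left_mono) auto
    then have "2 * x u * (\<Sum>i\<in>C - W. x i) \<le> qform C d x" using s q W(3) by linarith
    moreover have "2 * x u * (\<Sum>i\<in>C - W. x i) < qform C d x" if "\<forall>i\<in>C. 0 < x i"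
    proof -
      have "x w * x u < x w * (x p + x q)"
        using gt that wpq by (intro mult_strict_left_mono) auto
      then show ?thesis using s q W(3) by linarith
    qed
    ultimately show ?thesis using W by (intro exI[of _ W]) auto
  qed
qed

section \<open>Comparison with the extremal matrix\<close>

abbreviation star :: "'a set \<Rightarrow> 'a \<Rightarrow> 'a \<Rightarrow> real" where "star \<equiv> star_matrix u v"

lemma star_sym: "star W i j = star W j i"
  by (auto simp: star_matrix_def insert_commute)

lemma star_diag: "star W i i = 0"
  by (simp add: star_matrix_def)

lemma deficit_star_sum:
  assumes W: "W \<subseteq> V - {u, v}" and i: "i \<in> V"
  shows "(\<Sum>j\<in>V. deficit (star W) i j * x j) = (if i = u then 2 * x v + (\<Sum>j\<in>V - {u, v} - W. x j)
    else if i = v then 2 * x u else if i \<in> W then 0 else x u)"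
proof -
  have V: "V = insert u (insert v (V - {u, v}))" using uv by auto
  have s: "(\<Sum>j\<in>V. f j) = f u + f v + (\<Sum>j\<in>V - {u, v}. f j)" for f :: "'a \<Rightarrow> real"
    using fin uv(3) by (subst V) simp
  have "(\<Sum>j\<in>V - {u, v}. deficit (star W) u j * x j) = (\<Sum>j\<in>V - {u, v} - W. x j)"
  proof (rule sum.mono_neutral_cong_right)
    show "finite (V - {u, v})" using fin by simp
  qed (use uv(3) in \<open>auto simp: deficit_def star_matrix_def doubleton_eq_iff\<close>)
  moreover have "(\<Sum>j\<in>V - {u, v}. deficit (star W) i j * x j) = 0" if "i \<noteq> u"
    using that W by (intro sum.neutral) (auto simp: deficit_def star_matrix_def doubleton_eq_iff)
  ultimately show ?thesis
    using uv(3) W unfolding s by (auto simp: deficit_def star_matrix_def doubleton_eq_iff)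
qed

lemma qform_deficit_star:
  assumes W: "W \<subseteq> V - {u, v}"
  shows "qform V (deficit (star W)) x = 4 * (x u * x v) + 2 * x u * (\<Sum>j\<in>V - {u, v} - W. x j)"
proof -
  have V: "V = insert u (insert v (V - {u, v}))" using uv by auto
  have s: "(\<Sum>j\<in>V. f j) = f u + f v + (\<Sum>j\<in>V - {u, v}. f j)" for f :: "'a \<Rightarrow> real"
    using fin uv(3) by (subst V) simp
  have "qform V (deficit (star W)) x = (\<Sum>i\<in>V. x i * (\<Sum>j\<in>V. deficit (star W) i j * x j))"
    unfolding qform_def by (simp add: sum_distrib_left algebra_simps)
  also have "\<dots> = (\<Sum>i\<in>V. x i * (if i = u then 2 * x v + (\<Sum>j\<in>V - {u, v} - W. x j)
    else if i = v then 2 * x u else if i \<in> W then 0 else x u))"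
    using deficit_star_sum[OF W] by simp
  also have "\<dots> = x u * (2 * x v + (\<Sum>j\<in>V - {u, v} - W. x j)) + x v * (2 * x u)
      + (\<Sum>i\<in>V - {u, v}. x i * (if i \<in> W then 0 else x u))"
    using uv(3) unfolding s by (auto intro!: sum.cong)
  also have "(\<Sum>i\<in>V - {u, v}. x i * (if i \<in> W then 0 else x u)) = (\<Sum>i\<in>V - {u, v} - W. x i * x u)"
    by (rule sum.mono_neutral_cong_right) (use fin in auto)
  finally show ?thesis by (simp add: sum_distrib_left[symmetric] sum_distrib_right[symmetric] algebra_simps)
qed

text \<open>Equality in the comparison determines \<open>a\<close> only where the entries of
  \<open>x\<close> do not vanish. Rows in \<open>W\<close> have no deficit, so their entries equal
  the upper bound \<open>s / (l + 1)\<close> of all entries. Row \<open>u\<close> then makes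
  \<open>l * x u\<close> at least \<open>2 * (s / (l + 1)) - x v\<close>, which is positive, and the
  remaining entries follow from \<open>x u\<close>.\<close>

lemma star_extremal_positive:
  assumes W: "W \<subseteq> V - {u, v}" "2 \<le> card W"
    and eig: "\<And>i. i \<in> V \<Longrightarrow> (\<Sum>j\<in>V. star W i j * x j) = l * x i" and i: "i \<in> V"
  shows "0 < x i"
proof -
  define s where "s = (\<Sum>j\<in>V. x j)"
  have l1: "l + 1 > 0" using l_ge n_ge by linarith
  have E: "(l + 1) * x i = s - (\<Sum>j\<in>V. deficit (star W) i j * x j)" if "i \<in> V" for i
    using eig[OF that] sum_deficit[OF fin that, of "star W" x, OF star_diag]
    by (simp add: s_def algebra_simps)
  have "\<exists>k\<in>V. x k \<noteq> 0" using unit by (rule_tac ccontr) simp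
  then have s: "s > 0" unfolding s_def using nonneg fin by (metis less_eq_real_def sum_pos2)
  have finW: "finite W" using W(1) fin finite_subset by auto
  have w: "x w = s / (l + 1)" if "w \<in> W" for w
  proof -
    have "w \<in> V" "w \<noteq> u" "w \<noteq> v" using that W(1) by auto
    then have "(l + 1) * x w = s" using E[of w] deficit_star_sum[OF W(1), of w] that by simp
    then show ?thesis using l1 by (simp add: field_simps)
  qed
  have "x i \<le> s / (l + 1)" if "i \<in> V" for i
  proof -
    have "0 \<le> (\<Sum>j\<in>V. deficit (star W) i j * x j)"
      using nonneg by (intro sum_nonneg mult_nonneg_nonneg) (auto simp: deficit_def star_matrix_def)
    then show ?thesis using E[OF that] l1 by (simp add: field_simps)
  qed
  note le = this
  have sp: "s / (l + 1) > 0" using s l1 by simp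
  have "(\<Sum>j\<in>V. star W u j * x j) = s - x u - (2 * x v + (\<Sum>j\<in>V - {u, v} - W. x j))"
    using sum_deficit[OF fin uv(1), of "star W" x, OF star_diag] deficit_star_sum[OF W(1) uv(1)]
    by (simp add: s_def)
  moreover have "s = x u + x v + (\<Sum>j\<in>W. x j) + (\<Sum>j\<in>V - {u, v} - W. x j)"
  proof -
    have V: "V = insert u (insert v (V - {u, v}))" using uv by auto
    have "s = x u + x v + (\<Sum>j\<in>V - {u, v}. x j)"
      unfolding s_def using fin uv(3) by (subst V) simp
    then show ?thesis using sum.subset_diff[OF W(1), of x] fin by simp
  qed
  ultimately have "l * x u = (\<Sum>j\<in>W. x j) - x v" using eig[OF uv(1)] by simp
  also have "(\<Sum>j\<in>W. x j) = real (card W) * (s / (l + 1))" using w by simp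
  also have "2 * (s / (l + 1)) - s / (l + 1) \<le> real (card W) * (s / (l + 1)) - x v"
    using W(2) le[OF uv(2)] sp by (intro diff_mono mult_right_mono) auto
  finally have "0 < l * x u" using sp by linarith
  then have xu: "0 < x u" using l_ge n_ge by (simp add: zero_less_mult_iff)
  consider "i = u" | "i = v" | "i \<in> W" | "i \<in> V - {u, v} - W" using i by auto
  then show ?thesis
  proof cases
    case 4
    then have "(l + 1) * x i = s - x u" using E[OF i] deficit_star_sum[OF W(1) i] by auto
    moreover have "x u < s"
    proof -
      obtain y where "y \<in> W" using W(2) by fastforce
      then have "0 < x y" "y \<in> V" "y \<noteq> u" using w sp W(1) by auto
      then have "x u + x y = (\<Sum>j\<in>{u, y}. x j)" by simp
      also have "\<dots> \<le> s" unfolding s_def using fin uv \<open>y \<in> V\<close> nonneg by (intro sum_mono2) auto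
      finally show ?thesis using \<open>0 < x y\<close> by simp
    qed
    ultimately have "0 < (l + 1) * x i" by simp
    then show ?thesis using l1 by (simp add: zero_less_mult_iff)
  qed (use xu uv(5) w sp in auto)
qed


text \<open>By \<open>max\<close> no star matrix of size \<open>r\<close> beats \<open>l\<close>,
  while the deficit estimates produce one whose form at \<open>x\<close> is at least
  \<open>l\<close>. So all estimates are tight, \<open>x\<close> is a positive eigenvector of that
  star matrix, and each tight estimate fixes a part of \<open>a\<close>.\<close>

lemma extremal_is_star:
  assumes r: "2 \<le> r" "r + 2 \<le> card V"
    and few: "\<And>C. C \<subseteq> V - {u, v} \<Longrightarrow> \<forall>i\<in>C. a u i = 1 \<and> a v i = 1
      \<Longrightarrow> card (pair_edges (\<lambda>i j. a i j \<noteq> 0) C) \<le> r choose 2"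
    and max: "\<And>W y. W \<subseteq> V - {u, v} \<Longrightarrow> card W = r
      \<Longrightarrow> qform V (star W) y \<le> l * (\<Sum>i\<in>V. (y i)\<^sup>2)"
  shows "\<exists>W\<subseteq>V - {u, v}. card W = r \<and> (\<forall>i\<in>V. \<forall>j\<in>V. a i j = star W i j)"
proof -
  let ?V = "V - {u, v}"
  define C where "C = {i \<in> ?V. a u i = 1 \<and> a v i = 1}"
  have C: "C \<subseteq> ?V" by (auto simp: C_def)
  have finV: "finite ?V" using fin by simp
  have finC: "finite C" using C finV by (rule finite_subset)
  have nn: "0 \<le> x i" if "i \<in> ?V" for i using that nonneg by simp
  have xu: "0 \<le> x u" using nonneg uv by simp
  have "card (pair_edges (\<lambda>i j. a i j \<noteq> 0) C) \<le> r choose 2"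
    by (rule few[OF C]) (simp add: C_def)
  then obtain W' where W': "W' \<subseteq> C" "card W' \<le> r" "2 * x u * (\<Sum>i\<in>C - W'. x i) \<le> qform C d x"
    "W' \<noteq> C \<Longrightarrow> \<forall>i\<in>C. 0 < x i \<Longrightarrow> 2 * x u * (\<Sum>i\<in>C - W'. x i) < qform C d x"
    using prune_common_neighbours[OF r(1) C] by blast
  have "card ?V = card V - 2" using uv fin by (simp add: card_Diff_subset)
  then have "r \<le> card ?V" using r(2) by simp
  \<comment> \<open>Pruning may leave fewer than \<open>r\<close> vertices. Filling
    \<open>W'\<close> up to size \<open>r\<close> can only lower the deficit of the star
    matrix.\<close>
  then obtain W where W: "W' \<subseteq> W" "W \<subseteq> ?V" "card W = r"
    using exists_subset_between[of W' r ?V] W' C finV by (metis order_trans)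
  define rest where "rest = (\<Sum>i\<in>?V - C. (d u i * x u + d v i * x v) * x i)"
  have dC: "d u i = 0" "d v i = 0" if "i \<in> C" for i
    using that by (auto simp: C_def deficit_def)
  have "qform V d x = qform {u, v} d x + 2 * (\<Sum>i\<in>{u, v}. \<Sum>j\<in>?V. d i j * x i * x j) + qform ?V d x"
    using fin uv by (intro qform_split d_sym) auto
  also have "qform {u, v} d x = 4 * (x u * x v)"
    using uv by (subst qform_pair[OF uv(3) _ d_sym]) (auto simp: deficit_def)
  also have "(\<Sum>i\<in>{u, v}. \<Sum>j\<in>?V. d i j * x i * x j) = (\<Sum>j\<in>?V. (d u j * x u + d v j * x v) * x j)"
    using uv(3) by (simp add: sum.distrib[symmetric] algebra_simps)
  also have "\<dots> = rest + (\<Sum>j\<in>C. (d u j * x u + d v j * x v) * x j)"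
    unfolding rest_def by (rule sum.subset_diff[OF C finV])
  also have "(\<Sum>j\<in>C. (d u j * x u + d v j * x v) * x j) = 0" using dC by simp
  finally have qd: "qform V d x = 4 * (x u * x v) + 2 * rest + qform ?V d x" by simp
  \<comment> \<open>A vertex outside \<open>C\<close> has a missing or negative edge to
    \<open>u\<close> or to \<open>v\<close>. Since \<open>x u \<le> x v\<close>, the loss is at
    least \<open>x u\<close> either way, which is the most this vertex can lose in the star
    matrix.\<close>
  have cost: "x u \<le> d u i * x u + d v i * x v" if "i \<in> ?V - C" for i
  proof -
    have "1 \<le> d u i \<or> 1 \<le> d v i"
      using that vals[of u i] vals[of v i] by (auto simp: C_def deficit_def)
    then show ?thesis
    proof
      assume "1 \<le> d u i"
      then have "1 * x u \<le> d u i * x u" using xu by (intro mult_right_mono)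
      moreover have "0 \<le> d v i * x v" using d_nonneg nonneg uv by simp
      ultimately show ?thesis by linarith
    next
      assume "1 \<le> d v i"
      then have "1 * x v \<le> d v i * x v" using xu uv(5) by (intro mult_right_mono) auto
      moreover have "0 \<le> d u i * x u" using d_nonneg xu by simp
      ultimately show ?thesis using uv(5) by linarith
    qed
  qed
  have rest: "(\<Sum>i\<in>?V - C. x u * x i) \<le> rest"
    unfolding rest_def using cost nn by (intro sum_mono mult_right_mono) auto
  have mono: "qform C d x \<le> qform ?V d x"
    using finV C d_nonneg nn by (intro qform_mono_set) auto
  \<comment> \<open>The sum outside \<open>W'\<close> is split twice, along \<open>C\<close> and
    along \<open>W\<close>, in order to match the losses of \<open>a\<close> with those of the star
    matrix.\<close>
  have "(\<Sum>i\<in>?V - W'. x i) = (\<Sum>i\<in>?V - W' - (C - W'). x i) + (\<Sum>i\<in>C - W'. x i)"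
    using finV C by (intro sum.subset_diff) auto
  moreover have "?V - W' - (C - W') = ?V - C" using W'(1) by auto
  ultimately have split1: "(\<Sum>i\<in>?V - W'. x i) = (\<Sum>i\<in>?V - C. x i) + (\<Sum>i\<in>C - W'. x i)" by simp
  have "(\<Sum>i\<in>?V - W'. x i) = (\<Sum>i\<in>?V - W' - (W - W'). x i) + (\<Sum>i\<in>W - W'. x i)"
    using finV W by (intro sum.subset_diff) auto
  moreover have "?V - W' - (W - W') = ?V - W" using W(1) by auto
  ultimately have split2: "(\<Sum>i\<in>?V - W'. x i) = (\<Sum>i\<in>?V - W. x i) + (\<Sum>i\<in>W - W'. x i)" by simp
  define sW where "sW = (\<Sum>i\<in>?V - W. x i)"
  have WW: "0 \<le> (\<Sum>i\<in>W - W'. x i)" using W nn by (intro sum_nonneg) auto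
  have xWW: "0 \<le> x u * (\<Sum>i\<in>W - W'. x i)" using xu WW by simp
  have eqW: "x u * (\<Sum>i\<in>?V - C. x i) + x u * (\<Sum>i\<in>C - W'. x i) = x u * sW + x u * (\<Sum>i\<in>W - W'. x i)"
    using split1 split2 unfolding sW_def by (metis distrib_left)
  have restx: "x u * (\<Sum>i\<in>?V - C. x i) \<le> rest" using rest by (simp add: sum_distrib_left)
  have qs: "qform V (deficit (star W)) x = 4 * (x u * x v) + 2 * (x u * sW)"
    unfolding qform_deficit_star[OF W(2)] sW_def by simp
  have W'3: "2 * (x u * (\<Sum>i\<in>C - W'. x i)) \<le> qform C d x" using W'(3) by simp
  have def_a: "l = (\<Sum>i\<in>V. x i)\<^sup>2 - 1 - qform V d x"
    using qform_deficit[OF fin, of a x] diag unit qform_unit by simp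
  have def_s: "qform V (star W) x = (\<Sum>i\<in>V. x i)\<^sup>2 - 1 - qform V (deficit (star W)) x"
    using qform_deficit[OF fin, of "star W" x] star_diag unit by simp
  have star_le: "qform V (star W) x \<le> l" using max[OF W(2,3), of x] unit by simp
  \<comment> \<open>The deficit of \<open>a\<close> at \<open>x\<close> is at least that of the star
    matrix, so the form of the latter is at least \<open>l\<close>; \<open>star_le\<close> is the
    opposite inequality.\<close>
  have star_eq: "qform V (star W) x = l"
    using star_le def_a def_s qs qd restx mono eqW xWW W'3 by linarith
  have E: "(\<Sum>j\<in>V. star W i j * x j) = l * x i" if "i \<in> V" for i
    by (rule qform_max_eigen[OF fin star_sym max[OF W(2,3)] _ that]) (simp add: star_eq unit)
  have pos: "0 < x i" if "i \<in> V" for i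
    using star_extremal_positive[OF W(2) _ E that] W(3) r(1) by simp
  have xupos: "0 < x u" using pos uv by simp
  \<comment> \<open>Both ends of the chain of estimates coincide, so each link is an
    equality.\<close>
  have t1: "x u * (\<Sum>i\<in>W - W'. x i) = 0" "rest = x u * (\<Sum>i\<in>?V - C. x i)"
    "qform ?V d x = 2 * (x u * (\<Sum>i\<in>C - W'. x i))" "qform C d x = 2 * (x u * (\<Sum>i\<in>C - W'. x i))"
    using star_eq def_a def_s qs qd restx mono eqW xWW W'3 by linarith+
  have "\<forall>i\<in>C. 0 < x i" using C pos by auto
  \<comment> \<open>The strict clause of the pruning lemma shows that nothing was removed.\<close>
  then have W'C: "W' = C" using W'(4) t1(4) by (cases "W' = C") auto
  have "(\<Sum>i\<in>W - W'. x i) = 0" using t1(1) xupos by simp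
  then have "\<forall>i\<in>W - W'. x i = 0"
    using W nn finite_subset[OF W(2) finV] by (subst (asm) sum_nonneg_eq_0_iff) auto
  then have WC: "W = C" using W pos W'C by fastforce
  have "qform ?V d x = 0" using t1(3) W'C by simp
  have dV: "d i j = 0" if ij: "i \<in> ?V" "j \<in> ?V" for i j
  proof -
    have "d i j * x i * x j \<le> (\<Sum>j\<in>?V. d i j * x i * x j)"
      using ij finV d_nonneg nn by (intro member_le_sum[of j ?V "\<lambda>j. d i j * x i * x j"]) auto
    also have "\<dots> \<le> qform ?V d x" unfolding qform_def
      using ij finV d_nonneg nn
      by (intro member_le_sum[of i ?V "\<lambda>i. \<Sum>j\<in>?V. d i j * x i * x j"] sum_nonneg) auto
    also note \<open>qform ?V d x = 0\<close>
    finally have "d i j * (x i * x j) \<le> 0" by (simp add: mult.assoc)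
    moreover have "0 < x i * x j" using ij pos by simp
    ultimately show ?thesis using d_nonneg[of i j] by (meson less_eq_real_def mult_pos_pos not_le)
  qed
  have "(\<Sum>i\<in>?V - C. (d u i * x u + d v i * x v - x u) * x i) = 0"
    using t1(2) unfolding rest_def by (simp add: left_diff_distrib sum_subtractf sum_distrib_left)
  then have "\<forall>i\<in>?V - C. (d u i * x u + d v i * x v - x u) * x i = 0"
    using finV cost nn by (subst (asm) sum_nonneg_eq_0_iff) auto
  then have cost_eq: "d u i * x u + d v i * x v = x u" if "i \<in> ?V - C" for i
    using that pos by fastforce
  have dvals: "d i j \<in> {0, 1, 2}" for i j using vals[of i j] by (auto simp: deficit_def)
  \<comment> \<open>A defect at \<open>v\<close> would be compatible with \<open>cost_eq\<close>
    only if \<open>x v = x u\<close>. Then rows \<open>u\<close> and \<open>v\<close> of the star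
    equation have equal values, which makes the entries outside \<open>W\<close> sum to 0, against
    positivity at \<open>i\<close>.\<close>
  have duv: "d u i = 1 \<and> d v i = 0" if i: "i \<in> ?V - C" for i
  proof (cases "d v i = 0")
    case True
    then show ?thesis using cost_eq[OF i] xupos by simp
  next
    case False
    then have "1 \<le> d v i" using dvals[of v i] by auto
    then have "1 * x v \<le> d v i * x v" using pos uv by (intro mult_right_mono) (auto simp: less_imp_le)
    moreover have "0 \<le> d u i * x u" using d_nonneg xu by simp
    ultimately have "x v = x u" using cost_eq[OF i] uv(5) by linarith
    have "(\<Sum>j\<in>V. star W u j * x j) = (\<Sum>j\<in>V. star W v j * x j)"
      using E uv \<open>x v = x u\<close> by simp
    then have "(\<Sum>j\<in>?V - W. x j) = 0"
      using sum_deficit[OF fin uv(1), of "star W" x, OF star_diag] sum_deficit[OF fin uv(2), of "star W" x, OF star_diag]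
        deficit_star_sum[OF W(2) uv(1)] deficit_star_sum[OF W(2) uv(2)] uv(3) \<open>x v = x u\<close> by simp
    moreover have "0 < (\<Sum>j\<in>?V - W. x j)"
      using i WC finV pos nn by (intro sum_pos2[of _ i]) auto
    ultimately show ?thesis by simp
  qed
  have off: "a i j = 1 - d i j" if "i \<noteq> j" for i j using that by (simp add: deficit_def)
  have au: "a u j = star W u j" if "j \<in> V" for j
    using that uv WC duv[of j] dC[of j] off[of u j] diag W(2)
    by (cases "j = u \<or> j = v") (auto simp: star_matrix_def doubleton_eq_iff)
  have av: "a v j = star W v j" if "j \<in> V" for j
    using that uv WC duv[of j] dC[of j] off[of v j] diag W(2) au[of v] sym[of v u] star_sym[of W v u]
    by (cases "j = u \<or> j = v") (auto simp: star_matrix_def doubleton_eq_iff)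
  have "a i j = star W i j" if ij: "i \<in> V" "j \<in> V" for i j
  proof (cases "i \<in> {u, v} \<or> j \<in> {u, v}")
    case True
    then show ?thesis
      using ij au av sym[of i j] star_sym[of W i j] by auto
  next
    case False
    then show ?thesis
      using ij dV[of i j] off[of i j] diag by (cases "i = j") (auto simp: star_matrix_def doubleton_eq_iff)
  qed
  then show ?thesis using W by blast
qed

end

subsection \<open>Switching and balance\<close>

lemma adj_values: "signed_graph \<Gamma> \<Longrightarrow> adj \<Gamma> i j \<in> {-1, 0, 1}"
  by (auto simp: adj_def signed_graph_def)

lemma adj_diag: "signed_graph \<Gamma> \<Longrightarrow> adj \<Gamma> i i = 0"
  unfolding adj_def signed_graph_def by fastforce

lemma adj_eq_0_iff: "signed_graph \<Gamma> \<Longrightarrow> adj \<Gamma> i j = 0 \<longleftrightarrow> {i, j} \<notin> edges \<Gamma>"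
  by (auto simp: adj_def signed_graph_def)

lemma edge_in_verts: "signed_graph \<Gamma> \<Longrightarrow> {i, j} \<in> edges \<Gamma> \<Longrightarrow> i \<in> verts \<Gamma> \<and> j \<in> verts \<Gamma> \<and> i \<noteq> j"
  unfolding signed_graph_def by fastforce

lemma adj_switching:
  "adj (switching U \<Gamma>) i j = (if i \<in> U then -1 else 1) * (if j \<in> U then -1 else 1) * adj \<Gamma> i j"
  by (auto simp: adj_def switching_def)

lemma signed_graph_switching: "signed_graph \<Gamma> \<Longrightarrow> signed_graph (switching U \<Gamma>)"
  by (auto simp: signed_graph_def switching_def)

text \<open>Successive switchings compose to one conjugation by a sign diagonal; \<open>f\<close> is
  -1 at the vertices switched an odd number of times.\<close>

lemma switch_steps_adj:
  assumes "switch_step\<^sup>*\<^sup>* \<Gamma> \<Delta>"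
  shows "verts \<Delta> = verts \<Gamma> \<and>
    (\<exists>f. (\<forall>i. f i = 1 \<or> f i = (-1::real)) \<and> (\<forall>i j. adj \<Gamma> i j = f i * f j * adj \<Delta> i j))"
  using assms
proof (induction rule: rtranclp_induct)
  case base
  show ?case by (auto intro!: exI[of _ "\<lambda>_. 1"])
next
  case (step \<Delta> \<Delta>')
  then obtain f U where f: "\<And>i. f i = 1 \<or> f i = (-1::real)" "\<And>i j. adj \<Gamma> i j = f i * f j * adj \<Delta> i j"
    and U: "\<Delta>' = switching U \<Delta>" and V: "verts \<Delta> = verts \<Gamma>" unfolding switch_step_def by blast
  define h where "h i = f i * (if i \<in> U then -1 else 1)" for i
  have "adj \<Gamma> i j = h i * h j * adj \<Delta>' i j" for i j
    unfolding f(2) U adj_switching h_def by auto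
  moreover have "h i = 1 \<or> h i = -1" for i using f(1)[of i] by (auto simp: h_def)
  ultimately show ?case using V U by (auto simp: switching_def)
qed

lemma lambda1_switching_equivalent:
  fixes \<Gamma> :: "'a::linorder sgraph" and \<Gamma>' :: "'b::linorder sgraph"
  assumes "finite (verts \<Gamma>)" "verts \<Gamma> \<noteq> {}" "\<Gamma> \<sim>\<^sub>s \<Gamma>'"
  shows "lambda1 \<Gamma> = lambda1 \<Gamma>'"
proof -
  obtain \<Delta> where \<Delta>: "switch_step\<^sup>*\<^sup>* \<Gamma> \<Delta>" "sg_iso \<Delta> \<Gamma>'"
    using assms(3) unfolding switching_equivalent_def by blast
  obtain f where f: "verts \<Delta> = verts \<Gamma>" "\<And>i. f i = 1 \<or> f i = (-1::real)"
    "\<And>i j. adj \<Gamma> i j = f i * f j * adj \<Delta> i j"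
    using switch_steps_adj[OF \<Delta>(1)] by blast
  obtain g where g: "bij_betw g (verts \<Gamma>) (verts \<Gamma>')"
    "\<forall>i\<in>verts \<Gamma>. \<forall>j\<in>verts \<Gamma>. {i, j} \<in> edges \<Delta> \<longleftrightarrow> {g i, g j} \<in> edges \<Gamma>'"
    "\<forall>i\<in>verts \<Gamma>. \<forall>j\<in>verts \<Gamma>. {i, j} \<in> edges \<Delta> \<longrightarrow> sig \<Delta> {i, j} = sig \<Gamma>' {g i, g j}"
    using \<Delta>(2) f(1) unfolding sg_iso_def by auto
  show ?thesis
  proof (rule lambda1_eq_if_qform_eq[OF assms(1,2) g(1) f(2)])
    fix i j assume "i \<in> verts \<Gamma>" "j \<in> verts \<Gamma>"
    then have "adj \<Delta> i j = adj \<Gamma>' (g i) (g j)" using g(2,3) unfolding adj_def by simp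
    then show "adj \<Gamma> i j = f i * f j * adj \<Gamma>' (g i) (g j)" using f(3) by simp
  qed
qed

lemma sg_isoI_adj:
  assumes "signed_graph \<Gamma>" "signed_graph \<Gamma>'" "bij_betw g (verts \<Gamma>) (verts \<Gamma>')"
    and eq: "\<And>i j. i \<in> verts \<Gamma> \<Longrightarrow> j \<in> verts \<Gamma> \<Longrightarrow> adj \<Gamma> i j = adj \<Gamma>' (g i) (g j)"
  shows "sg_iso \<Gamma> \<Gamma>'"
  unfolding sg_iso_def
proof (intro exI[of _ g] conjI ballI impI assms(3))
  fix i j assume ij: "i \<in> verts \<Gamma>" "j \<in> verts \<Gamma>"
  show iff: "{i, j} \<in> edges \<Gamma> \<longleftrightarrow> {g i, g j} \<in> edges \<Gamma>'"
    using eq[OF ij] adj_eq_0_iff[OF assms(1), of i j] adj_eq_0_iff[OF assms(2), of "g i" "g j"] by simp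
  assume "{i, j} \<in> edges \<Gamma>"
  then show "sig \<Gamma> {i, j} = sig \<Gamma>' {g i, g j}" using eq[OF ij] iff by (simp add: adj_def)
qed

text \<open>A single switching at the set where \<open>f\<close> is -1 does it. A switching set must
  be nonempty and proper; in the two excluded cases \<open>f\<close> is constant on the vertices,
  all products \<open>f i * f j\<close> are 1, and an empty sequence of switchings serves.\<close>

lemma switching_equivalentI_adj:
  assumes sg: "signed_graph \<Gamma>" "signed_graph \<Gamma>'" and g: "bij_betw g (verts \<Gamma>) (verts \<Gamma>')"
    and f: "\<And>i. f i = 1 \<or> f i = (-1::real)"
    and eq: "\<And>i j. i \<in> verts \<Gamma> \<Longrightarrow> j \<in> verts \<Gamma> \<Longrightarrow> f i * f j * adj \<Gamma> i j = adj \<Gamma>' (g i) (g j)"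
  shows "\<Gamma> \<sim>\<^sub>s \<Gamma>'"
proof -
  define U where "U = {i \<in> verts \<Gamma>. f i = -1}"
  have fU: "f i = (if i \<in> U then -1 else 1)" if "i \<in> verts \<Gamma>" for i
    using f[of i] that by (auto simp: U_def)
  show ?thesis
  proof (cases "U = {} \<or> U = verts \<Gamma>")
    case True
    have "adj \<Gamma> i j = adj \<Gamma>' (g i) (g j)" if "i \<in> verts \<Gamma>" "j \<in> verts \<Gamma>" for i j
      using eq[OF that] fU that True by auto
    then have "sg_iso \<Gamma> \<Gamma>'" by (rule sg_isoI_adj[OF sg g])
    then show ?thesis unfolding switching_equivalent_def by blast
  next
    case False
    then have "U \<noteq> {} \<and> U \<subset> verts \<Gamma>" by (auto simp: U_def)
    then have "switch_step \<Gamma> (switching U \<Gamma>)" unfolding switch_step_def by (intro exI[of _ U]) simp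
    moreover have "sg_iso (switching U \<Gamma>) \<Gamma>'"
    proof (rule sg_isoI_adj[OF signed_graph_switching[OF sg(1)] sg(2)])
      show "bij_betw g (verts (switching U \<Gamma>)) (verts \<Gamma>')" using g by (simp add: switching_def)
      fix i j assume "i \<in> verts (switching U \<Gamma>)" "j \<in> verts (switching U \<Gamma>)"
      then have ij: "i \<in> verts \<Gamma>" "j \<in> verts \<Gamma>" by (auto simp: switching_def)
      show "adj (switching U \<Gamma>) i j = adj \<Gamma>' (g i) (g j)"
        using eq[OF ij] fU ij unfolding adj_switching by simp
    qed
    ultimately show ?thesis unfolding switching_equivalent_def by blast
  qed
qed

section \<open>Cycle signs and unbalanced copies of K_4\<close>

lemma positive_cycle_iff_prod:
  assumes "signed_graph \<Gamma>" "is_cycle \<Gamma> vs"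
  shows "positive_cycle \<Gamma> vs \<longleftrightarrow> (\<Prod>i<length vs. sig \<Gamma> (cycle_edge vs i)) = 1"
proof -
  let ?s = "\<lambda>i. sig \<Gamma> (cycle_edge vs i)"
  have "?s i = (if ?s i = -1 then -1 else 1)" if "i < length vs" for i
    using assms that unfolding signed_graph_def is_cycle_def by auto
  then have "(\<Prod>i<length vs. ?s i) = (\<Prod>i<length vs. if ?s i = -1 then -1 else 1)"
    by (intro prod.cong) auto
  also have "\<dots> = (\<Prod>i\<in>{i. i < length vs \<and> ?s i = -1}. -1)"
    by (rule prod.mono_neutral_cong_right) auto
  also have "\<dots> = (-1) ^ card {i. i < length vs \<and> ?s i = -1}" by simp
  finally show ?thesis by (simp add: positive_cycle_def minus_one_power_iff)
qed

lemma prod_cyclic_shift: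
  fixes g :: "nat \<Rightarrow> 'b::comm_monoid_mult"
  shows "(\<Prod>i<n. g (Suc i mod n)) = (\<Prod>i<n. g i)"
proof (cases n)
  case (Suc m)
  have "(\<Prod>i<Suc m. g (Suc i mod Suc m)) = (\<Prod>i<m. g (Suc i)) * g 0" by simp
  then show ?thesis unfolding Suc prod.lessThan_Suc_shift by (simp add: mult.commute)
qed simp

text \<open>The sign of an edge \<open>{i, j}\<close> is then \<open>f i * f j\<close>, so in the
  product along a cycle every vertex contributes its value of \<open>f\<close> twice and the product
  is 1.\<close>

lemma balancedI_adj:
  assumes sg: "signed_graph \<Gamma>" and f: "\<And>i. f i = 1 \<or> f i = (-1::real)"
    and nonneg: "\<And>i j. 0 \<le> f i * f j * adj \<Gamma> i j"
  shows "balanced \<Gamma>"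
  unfolding balanced_def
proof (intro allI impI)
  fix vs assume cyc: "is_cycle \<Gamma> vs"
  let ?n = "length vs"
  have e: "real_of_int (sig \<Gamma> (cycle_edge vs i)) = f (vs ! i) * f (vs ! (Suc i mod ?n))" if "i < ?n" for i
  proof -
    have "cycle_edge vs i \<in> edges \<Gamma>" using cyc that unfolding is_cycle_def by auto
    then have "sig \<Gamma> (cycle_edge vs i) = 1 \<or> sig \<Gamma> (cycle_edge vs i) = -1"
      "adj \<Gamma> (vs ! i) (vs ! (Suc i mod ?n)) = real_of_int (sig \<Gamma> (cycle_edge vs i))"
      using sg unfolding signed_graph_def adj_def cycle_edge_def by auto
    then show ?thesis
      using nonneg[of "vs ! i" "vs ! (Suc i mod ?n)"] f[of "vs ! i"] f[of "vs ! (Suc i mod ?n)"] by auto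
  qed
  have "real_of_int (\<Prod>i<?n. sig \<Gamma> (cycle_edge vs i)) = (\<Prod>i<?n. f (vs ! i) * f (vs ! (Suc i mod ?n)))"
    using e by simp
  also have "\<dots> = (\<Prod>i<?n. f (vs ! i)) * (\<Prod>i<?n. f (vs ! i))"
    using prod_cyclic_shift[of "\<lambda>i. f (vs ! i)" ?n] by (simp add: prod.distrib)
  also have "\<dots> = (\<Prod>i<?n. f (vs ! i) * f (vs ! i))" by (simp add: prod.distrib)
  also have "\<dots> = 1"
  proof (rule prod.neutral, rule ballI)
    fix i show "f (vs ! i) * f (vs ! i) = 1" using f[of "vs ! i"] by auto
  qed
  finally show "positive_cycle \<Gamma> vs"
    unfolding positive_cycle_iff_prod[OF sg cyc] by (simp only: of_int_eq_1_iff)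
qed

lemma unbalanced_induced_triangle:
  assumes sg: "signed_graph \<Gamma>" and X: "{i, j, k} \<subseteq> X" "X \<subseteq> verts \<Gamma>"
    and neg: "adj \<Gamma> i j * adj \<Gamma> j k * adj \<Gamma> k i = -1"
  shows "unbalanced (induced \<Gamma> X)"
proof -
  have "adj \<Gamma> i j \<noteq> 0" "adj \<Gamma> j k \<noteq> 0" "adj \<Gamma> k i \<noteq> 0" using neg by auto
  then have e: "{i, j} \<in> edges \<Gamma>" "{j, k} \<in> edges \<Gamma>" "{k, i} \<in> edges \<Gamma>"
    using adj_eq_0_iff[OF sg] by auto
  then have ne: "i \<noteq> j" "j \<noteq> k" "k \<noteq> i" using edge_in_verts[OF sg] by auto
  have sgX: "signed_graph (induced \<Gamma> X)"
    using sg X(2) finite_subset unfolding signed_graph_def induced_def by auto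
  have all3: "(\<forall>l<3. P l) \<longleftrightarrow> P 0 \<and> P 1 \<and> P (2::nat)" for P
    by (metis One_nat_def Suc_1 less_2_cases less_Suc_eq numeral_3_eq_3 zero_less_Suc)
  have ce: "cycle_edge [i, j, k] 0 = {i, j}" "cycle_edge [i, j, k] 1 = {j, k}"
    "cycle_edge [i, j, k] 2 = {k, i}" by (simp_all add: cycle_edge_def)
  have cyc: "is_cycle (induced \<Gamma> X) [i, j, k]"
    unfolding is_cycle_def using ne X e all3[of "\<lambda>l. cycle_edge [i, j, k] l \<in> edges (induced \<Gamma> X)"]
    by (auto simp: induced_def ce[simplified])
  have "{..<3::nat} = {0, 1, 2}" by auto
  then have "(\<Prod>l<3. sig (induced \<Gamma> X) (cycle_edge [i, j, k] l))
      = sig \<Gamma> {i, j} * sig \<Gamma> {j, k} * sig \<Gamma> {k, i}"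
    by (simp add: ce[simplified] induced_def mult.assoc)
  moreover have "real_of_int (sig \<Gamma> {i, j} * sig \<Gamma> {j, k} * sig \<Gamma> {k, i}) = real_of_int (-1)"
    using neg e by (simp add: adj_def)
  then have "sig \<Gamma> {i, j} * sig \<Gamma> {j, k} * sig \<Gamma> {k, i} = -1" by (simp only: of_int_eq_iff)
  ultimately have "(\<Prod>l<length [i, j, k]. sig (induced \<Gamma> X) (cycle_edge [i, j, k] l)) \<noteq> 1"
    by (simp add: numeral_3_eq_3[symmetric])
  then have "\<not> positive_cycle (induced \<Gamma> X) [i, j, k]"
    unfolding positive_cycle_iff_prod[OF sgX cyc] .
  then show ?thesis using cyc unfolding balanced_def by blast
qed

lemma sg_iso_refl: "sg_iso \<Gamma> \<Gamma>"
  unfolding sg_iso_def by (intro exI[of _ "\<lambda>i. i"]) (auto simp: bij_betw_def)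

text \<open>The union of any \<open>t\<close> of the copies, with the signs of \<Gamma>, would be a
  forbidden subgraph.\<close>

lemma card_unbalanced_K4_less:
  assumes sg: "signed_graph \<Gamma>" and free: "free_of (tK4_minus t) \<Gamma>"
    and S: "\<And>X. X \<in> S \<Longrightarrow> card X = 4 \<and> X \<subseteq> verts \<Gamma> \<and> {e. e \<subseteq> X \<and> card e = 2} \<subseteq> edges \<Gamma>
      \<and> unbalanced (induced \<Gamma> X)"
  shows "card S < t"
proof (rule ccontr)
  assume "\<not> card S < t"
  then obtain T where T: "T \<subseteq> S" "card T = t" by (meson not_less obtain_subset_with_card_n)
  define H where "H = \<lparr>verts = \<Union>T, edges = (\<Union>X\<in>T. {e. e \<subseteq> X \<and> card e = 2}), sig = sig \<Gamma>\<rparr>"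
  have sub: "verts H \<subseteq> verts \<Gamma>" "edges H \<subseteq> edges \<Gamma>" using S T(1) unfolding H_def by fastforce+
  have "finite (verts H)" using sg sub(1) finite_subset unfolding signed_graph_def by auto
  moreover have "e \<subseteq> verts H \<and> card e = 2" if "e \<in> edges H" for e
    using that by (auto simp: H_def)
  moreover have "sig H e = 1 \<or> sig H e = -1" if "e \<in> edges H" for e
    using sg sub(2) that unfolding signed_graph_def by (auto simp: H_def)
  ultimately have sgH: "signed_graph H" unfolding signed_graph_def by simp
  \<comment> \<open>Every pair in \<open>X\<close> is an edge of both graphs, so overlapping copies
    add nothing inside \<open>X\<close> and the imbalance carries over to \<open>H\<close>.\<close>
  have "induced H X = induced \<Gamma> X" if "X \<in> T" for X
  proof -
    have "e \<in> edges H" if e: "e \<in> edges \<Gamma>" "e \<subseteq> X" for e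
      using e sg \<open>X \<in> T\<close> unfolding H_def signed_graph_def by auto
    then have E: "{e \<in> edges H. e \<subseteq> X} = {e \<in> edges \<Gamma>. e \<subseteq> X}" using sub(2) by auto
    show ?thesis unfolding induced_def E by (rule sgraph.equality) (simp_all add: H_def)
  qed
  then have "H \<in> tK4_minus t"
    using sgH T S unfolding tK4_minus_def consists_of_K4s_def
    by (auto simp: H_def intro!: exI[of _ T])
  moreover have "subgraph H \<Gamma>" using sub unfolding subgraph_def by (simp add: H_def)
  ultimately show False using free sgH sg_iso_refl unfolding free_of_def by blast
qed

subsection \<open>The extremal graph\<close>

lemma signed_graph_Gamma_sn:
  assumes "1 \<le> r" "r + 2 \<le> n"
  shows "signed_graph (Gamma_sn r n)"
proof -
  have "e \<subseteq> {1..n} \<and> card e = 2" if e: "e \<in> edges (Gamma_sn r n)" for e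
  proof -
    consider "e \<subseteq> {1..n - 1}" "card e = 2" | i where "e = {n, i}" "1 \<le> i" "i \<le> r + 1"
      using e by (auto simp: Gamma_sn_def)
    then show ?thesis
    proof cases
      case 1
      moreover have "{1..n - 1} \<subseteq> {1..n}" by auto
      ultimately show ?thesis by blast
    qed (use assms in auto)
  qed
  moreover have "sig (Gamma_sn r n) e = 1 \<or> sig (Gamma_sn r n) e = -1" for e
    by (simp add: Gamma_sn_def)
  moreover have "verts (Gamma_sn r n) = {1..n}" by (simp add: Gamma_sn_def)
  ultimately show ?thesis unfolding signed_graph_def by simp
qed

lemma adj_Gamma_sn:
  assumes r: "r + 2 \<le> n" and ij: "i \<in> {1..n}" "j \<in> {1..n}"
  shows "adj (Gamma_sn r n) i j = star_matrix n 1 {2..r + 1} i j"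
proof -
  have n: "n \<notin> {1..n - 1}" using r by auto
  have e: "{i, j} \<in> edges (Gamma_sn r n) \<longleftrightarrow> i \<noteq> j \<and> (i = n \<longrightarrow> j \<le> r + 1) \<and> (j = n \<longrightarrow> i \<le> r + 1)"
    using ij r by (auto simp: Gamma_sn_def card_2_iff doubleton_eq_iff)
  show ?thesis
    using ij r unfolding adj_def e star_matrix_def by (auto simp: Gamma_sn_def doubleton_eq_iff)
qed

text \<open>The star matrix distinguishes only the classes \<open>u\<close>, \<open>v\<close>,
  \<open>W\<close> and the rest, so any bijection that respects them will do; they go to
  \<open>n\<close>, to 1, to \<open>{2..r + 1}\<close> and to \<open>{r + 2..n - 1}\<close>.\<close>

lemma Gamma_sn_labelling:
  assumes V: "finite V" "card V = n" and uv: "u \<in> V" "v \<in> V" "u \<noteq> v"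
    and W: "W \<subseteq> V - {u, v}" "card W = r" and r: "r + 2 \<le> n"
  shows "\<exists>g. bij_betw g V {1..n}
    \<and> (\<forall>i\<in>V. \<forall>j\<in>V. adj (Gamma_sn r n) (g i) (g j) = star_matrix u v W i j)"
proof -
  let ?R = "V - {u, v} - W"
  have fW: "finite W" using W(1) V(1) finite_subset by auto
  have "card (V - {u, v}) = n - 2" using uv V by (simp add: card_Diff_subset)
  then have cR: "card ?R = n - 2 - r" using W fW by (simp add: card_Diff_subset)
  obtain p where p: "bij_betw p W {2..r + 1}"
    using finite_same_card_bij[OF fW, of "{2..r + 1}"] W(2) by auto
  obtain q where q: "bij_betw q ?R {r + 2..n - 1}"
    using finite_same_card_bij[of ?R "{r + 2..n - 1}"] cR V(1) by auto
  define g where "g = (\<lambda>i. if i = u then n else if i = v then 1 else if i \<in> W then p i else q i)"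
  have "bij_betw g W {2..r + 1} \<longleftrightarrow> bij_betw p W {2..r + 1}"
    by (rule bij_betw_cong) (use W(1) in \<open>auto simp: g_def\<close>)
  then have gWbij: "bij_betw g W {2..r + 1}" using p by simp
  have "bij_betw g ?R {r + 2..n - 1} \<longleftrightarrow> bij_betw q ?R {r + 2..n - 1}"
    by (rule bij_betw_cong) (auto simp: g_def)
  then have "bij_betw g ?R {r + 2..n - 1}" using q by simp
  with gWbij have "bij_betw g (W \<union> ?R) ({2..r + 1} \<union> {r + 2..n - 1})"
    by (rule bij_betw_combine) auto
  moreover have "bij_betw g {u, v} {n, 1}" using uv(3) r by (auto simp: g_def bij_betw_def)
  ultimately have "bij_betw g (W \<union> ?R \<union> {u, v}) ({2..r + 1} \<union> {r + 2..n - 1} \<union> {n, 1})"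
    by (rule bij_betw_combine) (use r in auto)
  moreover have "W \<union> ?R \<union> {u, v} = V" using W(1) uv by auto
  moreover have "{2..r + 1} \<union> {r + 2..n - 1} \<union> {n, 1} = {1..n}" using r by auto
  ultimately have g: "bij_betw g V {1..n}" by simp
  have inj: "g i = g j \<longleftrightarrow> i = j" if "i \<in> V" "j \<in> V" for i j
    using g that unfolding bij_betw_def inj_on_def by blast
  have gu: "g u = n" and gv: "g v = 1" using uv(3) by (auto simp: g_def)
  have gW: "g i \<in> {2..r + 1} \<longleftrightarrow> i \<in> W" if i: "i \<in> V" for i
  proof
    assume "i \<in> W" then show "g i \<in> {2..r + 1}" using gWbij bij_betwE by blast
  next
    assume "g i \<in> {2..r + 1}"
    then obtain k where "k \<in> W" "g i = g k"
      using gWbij unfolding bij_betw_def by (metis imageE)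
    then show "i \<in> W" using inj[OF i, of k] W(1) by auto
  qed
  have "adj (Gamma_sn r n) (g i) (g j) = star_matrix u v W i j" if ij: "i \<in> V" "j \<in> V" for i j
  proof -
    have "g i \<in> {1..n}" "g j \<in> {1..n}" using g ij bij_betwE by blast+
    then show ?thesis
      using ij uv inj[OF ij] inj[OF ij(1) uv(1)] inj[OF ij(1) uv(2)] inj[OF ij(2) uv(1)]
        inj[OF ij(2) uv(2)] gW[OF ij(1)] gW[OF ij(2)] gu gv
      unfolding adj_Gamma_sn[OF r \<open>g i \<in> {1..n}\<close> \<open>g j \<in> {1..n}\<close>] star_matrix_def doubleton_eq_iff
      by auto
  qed
  then show ?thesis using g by blast
qed

text \<open>The test vector is the indicator of the positive K_{n-1}, which has index n - 2.\<close>

lemma lambda1_Gamma_sn_ge: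
  assumes r: "1 \<le> r" "r + 2 \<le> n"
  shows "real n - 2 \<le> lambda1 (Gamma_sn r n)"
proof -
  let ?G = "Gamma_sn r n"
  let ?y = "\<lambda>i::nat. if i = n then 0 else 1 :: real"
  have V: "verts ?G = {1..n}" by (simp add: Gamma_sn_def)
  have N: "{1..n} = insert n {1..n - 1}" "n \<notin> {1..n - 1}" using r by auto
  have s: "(\<Sum>i\<in>{1..n}. f i) = f n + (\<Sum>i\<in>{1..n - 1}. f i)" for f :: "nat \<Rightarrow> real"
    unfolding N(1) using N(2) by simp
  have "adj ?G i j = (if i = j then 0 else 1)" if "i \<in> {1..n - 1}" "j \<in> {1..n - 1}" for i j
    using that r by (subst adj_Gamma_sn[OF r(2)]) (auto simp: star_matrix_def doubleton_eq_iff)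
  note A = this
  have "qform {1..n} (adj ?G) ?y = (\<Sum>i\<in>{1..n - 1}. \<Sum>j\<in>{1..n - 1}. adj ?G i j * ?y i * ?y j)"
    unfolding qform_def s by simp
  also have "\<dots> = (\<Sum>i\<in>{1..n - 1}. \<Sum>j\<in>{1..n - 1}. 1 - (if i = j then 1 else 0))"
    using A by (intro sum.cong refl) auto
  also have "\<dots> = (\<Sum>i\<in>{1..n - 1}. real (n - 1) - 1)"
    by (intro sum.cong refl) (simp add: sum_subtractf)
  also have "\<dots> = (real n - 2) * real (n - 1)" using r by (simp add: of_nat_diff algebra_simps)
  finally have q: "qform {1..n} (adj ?G) ?y = (real n - 2) * real (n - 1)" .
  have "(\<Sum>i\<in>{1..n - 1}. (?y i)\<^sup>2) = (\<Sum>i\<in>{1..n - 1}. 1)"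
    by (intro sum.cong refl) (use N(2) in auto)
  then have "(\<Sum>i\<in>{1..n}. (?y i)\<^sup>2) = real (n - 1)" unfolding s by simp
  moreover have "\<forall>y. qform {1..n} (adj ?G) y \<le> lambda1 ?G * (\<Sum>i\<in>{1..n}. (y i)\<^sup>2)"
    using lambda1_attained[of ?G] r unfolding V by auto
  ultimately have "(real n - 2) * real (n - 1) \<le> lambda1 ?G * real (n - 1)" using q by metis
  then show ?thesis using r by (subst (asm) mult_le_cancel_right) auto
qed

text \<open>Each of the counted edges spans an unbalanced \<open>K\<^sub>4\<close> together with the negative edge \<open>uv\<close>.\<close>

lemma card_pair_edges_less:
  assumes sg: "signed_graph \<Gamma>" and free: "free_of (tK4_minus t) \<Gamma>"
    and f: "\<And>i. f i = 1 \<or> f i = (-1::real)"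
    and b: "\<And>i j. b i j = f i * f j * adj \<Gamma> i j"
    and uv: "u \<in> verts \<Gamma>" "v \<in> verts \<Gamma>" "b u v = -1"
    and C: "C \<subseteq> verts \<Gamma> - {u, v}" "\<forall>i\<in>C. b u i = 1 \<and> b v i = 1"
  shows "card (pair_edges (\<lambda>i j. b i j \<noteq> 0) C) < t"
proof -
  let ?F = "pair_edges (\<lambda>i j. b i j \<noteq> 0) C"
  have edge: "{i, j} \<in> edges \<Gamma>" if "b i j \<noteq> 0" for i j
    using that b adj_eq_0_iff[OF sg] by simp
  have uvne: "u \<noteq> v" using edge[of u v] uv(3) edge_in_verts[OF sg] by auto
  have "inj_on (\<lambda>e. e \<union> {u, v}) ?F"
    using C(1) unfolding inj_on_def pair_edges_def by blast
  then have "card ?F = card ((\<lambda>e. e \<union> {u, v}) ` ?F)" by (rule card_image[symmetric])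
  also have "\<dots> < t"
  proof (rule card_unbalanced_K4_less[OF sg free])
    fix X assume "X \<in> (\<lambda>e. e \<union> {u, v}) ` ?F"
    then obtain i j where ij: "i \<in> C" "j \<in> C" "i \<noteq> j" "b i j \<noteq> 0" and X: "X = {i, j, u, v}"
      unfolding pair_edges_def by auto
    have ne: "i \<noteq> u" "i \<noteq> v" "j \<noteq> u" "j \<noteq> v" using ij C(1) by auto
    have XV: "X \<subseteq> verts \<Gamma>" using ij C(1) uv X by auto
    have "{u, i} \<in> edges \<Gamma>" "{v, i} \<in> edges \<Gamma>" "{u, j} \<in> edges \<Gamma>" "{v, j} \<in> edges \<Gamma>"
      "{u, v} \<in> edges \<Gamma>" "{i, j} \<in> edges \<Gamma>"
      using ij C(2) uv(3) by (auto intro!: edge)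
    then have "{e. e \<subseteq> X \<and> card e = 2} \<subseteq> edges \<Gamma>"
      unfolding X by (auto simp: card_2_iff insert_commute)
    \<comment> \<open>Switching preserves the sign of a triangle, because each factor of
      \<open>f\<close> occurs twice.\<close>
    moreover have "adj \<Gamma> u v * adj \<Gamma> v i * adj \<Gamma> i u = -1"
    proof -
      have "b u v * b v i * b u i = -1" using ij(1) C(2) uv(3) by simp
      moreover have "b u v * b v i * b u i
          = (f u * f u) * (f v * f v) * (f i * f i) * (adj \<Gamma> u v * adj \<Gamma> v i * adj \<Gamma> i u)"
        unfolding b by (simp add: adj_sym[of \<Gamma> u i] algebra_simps)
      moreover have "f k * f k = 1" for k using f[of k] by auto
      ultimately show ?thesis by simp
    qed
    then have "unbalanced (induced \<Gamma> X)"
      by (rule unbalanced_induced_triangle[OF sg _ XV, rotated]) (auto simp: X)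
    moreover have "card X = 4" unfolding X using ne ij(3) uvne by simp
    ultimately show "card X = 4 \<and> X \<subseteq> verts \<Gamma> \<and> {e. e \<subseteq> X \<and> card e = 2} \<subseteq> edges \<Gamma>
        \<and> unbalanced (induced \<Gamma> X)" using XV by simp
  qed
  finally show ?thesis .
qed

text \<open>Bound and equality case in one: a graph whose index reaches that of \<Gamma>_{r,n} is
  switching equivalent to it, hence has the same index. The alternatives in \<open>few\<close> stand
  for the two cases of the theorem and lead to the same bound on the number of edges.\<close>

lemma extremal_graph:
  fixes \<Gamma> :: "'a::linorder sgraph"
  assumes sg: "signed_graph \<Gamma>" and n: "card (verts \<Gamma>) = n" "20 \<le> n" and unb: "unbalanced \<Gamma>"
    and r: "2 \<le> r" "r + 2 \<le> n"
    and few: "free_of (tK4_minus (Suc (r choose 2))) \<Gamma> \<or> r = n - 2"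
    and ge: "lambda1 (Gamma_sn r n) \<le> lambda1 \<Gamma>"
  shows "\<Gamma> \<sim>\<^sub>s Gamma_sn r n"
proof -
  define V where "V = verts \<Gamma>"
  define l where "l = lambda1 \<Gamma>"
  let ?G = "Gamma_sn r n"
  have fin: "finite V" using sg unfolding signed_graph_def V_def by simp
  have ne: "V \<noteq> {}" using n V_def by auto
  obtain x where x: "(\<Sum>i\<in>V. (x i)\<^sup>2) = 1" "qform V (adj \<Gamma>) x = l"
    "\<And>y. qform V (adj \<Gamma>) y \<le> l * (\<Sum>i\<in>V. (y i)\<^sup>2)"
    using lambda1_attained[of \<Gamma>] fin ne unfolding V_def l_def by auto
  \<comment> \<open>Switching at the negative entries turns \<open>x\<close> into its absolute value
    \<open>y\<close>, an eigenvector of the switched matrix \<open>b\<close> for the same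
    eigenvalue.\<close>
  define f :: "'a \<Rightarrow> real" where "f i = (if x i < 0 then -1 else 1)" for i
  have f: "f i = 1 \<or> f i = -1" for i by (simp add: f_def)
  define b where "b i j = f i * f j * adj \<Gamma> i j" for i j
  define y where "y i = \<bar>x i\<bar>" for i
  have bq: "qform V b z = qform V (adj \<Gamma>) (\<lambda>i. f i * z i)" for z
    unfolding qform_def b_def by (intro sum.cong refl) simp
  have fy: "f i * y i = x i" for i by (simp add: f_def y_def)
  have ysq: "(y i)\<^sup>2 = (x i)\<^sup>2" for i by (simp add: y_def)
  have fsq: "(f i * z)\<^sup>2 = z\<^sup>2" for i z by (simp add: f_def)
  have bsym: "b i j = b j i" for i j by (simp add: b_def adj_sym[of \<Gamma> i j])
  have bmax: "qform V b z \<le> l * (\<Sum>i\<in>V. (z i)\<^sup>2)" for z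
    using x(3)[of "\<lambda>i. f i * z i"] unfolding bq fsq .
  have ymax: "qform V b y = l" "(\<Sum>i\<in>V. (y i)\<^sup>2) = 1" using x unfolding bq fy ysq by auto
  have beig: "(\<Sum>j\<in>V. b i j * y j) = l * y i" if "i \<in> V" for i
    by (rule qform_max_eigen[OF fin bsym bmax _ that]) (simp add: ymax)
  have bvals: "b i j \<in> {-1, 0, 1}" for i j
    using adj_values[OF sg, of i j] f[of i] f[of j] by (auto simp: b_def)
  have bdiag: "b i i = 0" for i using adj_diag[OF sg] by (simp add: b_def)
  \<comment> \<open>Without a negative entry in \<open>b\<close>, the signs \<open>f\<close> would
    show that \<Gamma> is balanced. Symmetry of \<open>b\<close> allows naming the ends so that
    \<open>y u \<le> y v\<close>.\<close>
  have "\<exists>u v. b u v = -1 \<and> y u \<le> y v"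
  proof (rule ccontr)
    assume no: "\<not> ?thesis"
    have "0 \<le> b i j" for i j
      using no bvals[of i j] bsym[of i j] linear[of "y i" "y j"] by auto
    then have "balanced \<Gamma>" by (intro balancedI_adj[OF sg f]) (simp add: b_def)
    then show False using unb by simp
  qed
  then obtain u v where neg: "b u v = -1" "y u \<le> y v" by blast
  then have "adj \<Gamma> u v \<noteq> 0" by (auto simp: b_def)
  then have uvV: "u \<in> V" "v \<in> V" "u \<noteq> v"
    using adj_eq_0_iff[OF sg] edge_in_verts[OF sg] unfolding V_def by auto
  have cV: "card V = n" using n V_def by simp
  have lge: "real n - 2 \<le> l"
    using lambda1_Gamma_sn_ge[of r n] r ge unfolding l_def by simp
  interpret nonneg_eigenvector V b y l u v
    by unfold_locales (use fin n cV bsym bdiag bvals ymax beig lge neg uvV in \<open>auto simp: y_def\<close>)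
  have fewC: "card (pair_edges (\<lambda>i j. b i j \<noteq> 0) C) \<le> r choose 2"
    if C: "C \<subseteq> V - {u, v}" "\<forall>i\<in>C. b u i = 1 \<and> b v i = 1" for C
    using few
  proof
    assume "free_of (tK4_minus (Suc (r choose 2))) \<Gamma>"
    then have "card (pair_edges (\<lambda>i j. b i j \<noteq> 0) C) < Suc (r choose 2)"
      by (rule card_pair_edges_less[OF sg _ f b_def]) (use uvV neg(1) C in \<open>auto simp: V_def\<close>)
    then show ?thesis by simp
  next
    \<comment> \<open>Only \<open>n - 2\<close> vertices differ from \<open>u\<close> and
      \<open>v\<close>, so the bound is the number of all pairs among them.\<close>
    assume rn: "r = n - 2"
    have "card (V - {u, v}) = n - 2" using uvV fin cV by (simp add: card_Diff_subset)
    moreover have "card (pair_edges (\<lambda>i j. b i j \<noteq> 0) C) \<le> card {e. e \<subseteq> V - {u, v} \<and> card e = 2}"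
      using fin C(1) by (intro card_mono) (auto simp: pair_edges_def)
    ultimately show ?thesis using n_subsets[of "V - {u, v}" 2] fin rn by simp
  qed
  have VG: "verts ?G = {1..n}" by (simp add: Gamma_sn_def)
  \<comment> \<open>A star matrix with \<open>card W = r\<close> is \<Gamma>_{r,n} relabelled, so
    its Rayleigh quotients are at most the index of \<Gamma>_{r,n}, which is at most
    \<open>l\<close> by \<open>ge\<close>.\<close>
  have starmax: "qform V (star W) z \<le> l * (\<Sum>i\<in>V. (z i)\<^sup>2)"
    if W: "W \<subseteq> V - {u, v}" "card W = r" for W z
  proof -
    obtain g where g: "bij_betw g V {1..n}"
      "\<forall>i\<in>V. \<forall>j\<in>V. adj ?G (g i) (g j) = star_matrix u v W i j"
      using Gamma_sn_labelling[OF fin cV uvV W r(2)] by blast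
    define z' where "z' k = z (the_inv_into V g k)" for k
    have z': "z' (g i) = z i" if "i \<in> V" for i
      unfolding z'_def using the_inv_into_f_f[OF bij_betw_imp_inj_on[OF g(1)] that] by simp
    have "qform V (star W) z = qform V (\<lambda>i j. adj ?G (g i) (g j)) (\<lambda>i. z' (g i))"
      using g(2) z' by (intro qform_cong) auto
    also have "\<dots> = qform {1..n} (adj ?G) z'" by (rule qform_reindex[OF g(1)])
    also have "\<dots> \<le> lambda1 ?G * (\<Sum>i\<in>{1..n}. (z' i)\<^sup>2)"
      using lambda1_attained[of ?G] n unfolding VG by auto
    also have "\<dots> \<le> l * (\<Sum>i\<in>{1..n}. (z' i)\<^sup>2)"
      unfolding l_def using ge by (intro mult_right_mono sum_nonneg) auto
    also have "(\<Sum>i\<in>{1..n}. (z' i)\<^sup>2) = (\<Sum>i\<in>V. (z' (g i))\<^sup>2)"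
      by (rule sum.reindex_bij_betw[OF g(1), symmetric])
    also have "\<dots> = (\<Sum>i\<in>V. (z i)\<^sup>2)" using z' by simp
    finally show ?thesis .
  qed
  obtain W where W: "W \<subseteq> V - {u, v}" "card W = r" "\<forall>i\<in>V. \<forall>j\<in>V. b i j = star W i j"
    using extremal_is_star[OF r(1) _ fewC starmax] r(2) unfolding cV by blast
  obtain g where g: "bij_betw g V {1..n}"
    "\<forall>i\<in>V. \<forall>j\<in>V. adj ?G (g i) (g j) = star_matrix u v W i j"
    using Gamma_sn_labelling[OF fin cV uvV W(1,2) r(2)] by blast
  show ?thesis
  proof (rule switching_equivalentI_adj[OF sg _ _ f])
    show "signed_graph ?G" using r by (intro signed_graph_Gamma_sn) auto
    show "bij_betw g (verts \<Gamma>) (verts ?G)" using g(1) unfolding VG V_def .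
    show "f i * f j * adj \<Gamma> i j = adj ?G (g i) (g j)" if "i \<in> verts \<Gamma>" "j \<in> verts \<Gamma>" for i j
      using W(3) g(2) that unfolding b_def V_def by simp
  qed
qed

theorem theorem1p3:
  "\<exists>N::nat. \<forall>n\<ge>N. \<forall>(t::nat) (r::nat) (\<Gamma>::nat sgraph).
     2 \<le> t \<longrightarrow> real r = (1 + sqrt (8 * real t - 7)) / 2 \<longrightarrow>
     signed_graph \<Gamma> \<longrightarrow> card (verts \<Gamma>) = n \<longrightarrow> unbalanced \<Gamma> \<longrightarrow> free_of (tK4_minus t) \<Gamma> \<longrightarrow>
       (t \<le> (n - 2) choose 2 \<longrightarrow>
          lambda1 \<Gamma> \<le> lambda1 (Gamma_sn r n) \<and>
          (lambda1 \<Gamma> = lambda1 (Gamma_sn r n) \<longleftrightarrow> \<Gamma> \<sim>\<^sub>s Gamma_sn r n)) \<and>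
       (t \<ge> ((n - 2) choose 2) + 1 \<longrightarrow>
          lambda1 \<Gamma> \<le> lambda1 (Gamma_sn (n - 2) n) \<and>
          (lambda1 \<Gamma> = lambda1 (Gamma_sn (n - 2) n) \<longleftrightarrow> \<Gamma> \<sim>\<^sub>s Gamma_sn (n - 2) n))"
proof (intro exI[of _ 20] allI impI)
  fix n t r :: nat and \<Gamma> :: "nat sgraph"
  assume n: "20 \<le> n" and t: "2 \<le> t" and rt: "real r = (1 + sqrt (8 * real t - 7)) / 2"
    and sg: "signed_graph \<Gamma>" "card (verts \<Gamma>) = n" "unbalanced \<Gamma>" and free: "free_of (tK4_minus t) \<Gamma>"
  have fin: "finite (verts \<Gamma>)" "verts \<Gamma> \<noteq> {}" using sg n unfolding signed_graph_def by auto
  \<comment> \<open>If the index of \<Gamma> is at least the other one,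
    \<open>extremal_graph\<close> gives equivalence and thereby equality; otherwise the inequality
    is strict, and equivalence would contradict it.\<close>
  have bound: "lambda1 \<Gamma> \<le> lambda1 (Gamma_sn s n) \<and>
      (lambda1 \<Gamma> = lambda1 (Gamma_sn s n) \<longleftrightarrow> \<Gamma> \<sim>\<^sub>s Gamma_sn s n)"
    if s: "2 \<le> s" "s + 2 \<le> n" "free_of (tK4_minus (Suc (s choose 2))) \<Gamma> \<or> s = n - 2" for s
    using extremal_graph[OF sg(1,2) n sg(3) s] lambda1_switching_equivalent[OF fin, of "Gamma_sn s n"]
    by linarith
  \<comment> \<open>Squaring away the root leads to \<open>t = Suc (r choose 2)\<close>, the form in
    which \<open>extremal_graph\<close> takes freeness.\<close>
  have "2 * real r - 1 = sqrt (8 * real t - 7)" using rt by simp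
  then have "(2 * real r - 1)\<^sup>2 = 8 * real t - 7" using t by simp
  then have "real (r * r) + 2 = real (r + 2 * t)" by (simp add: power2_eq_square algebra_simps)
  then have rr: "r * r + 2 = r + 2 * t" by (metis of_nat_add of_nat_eq_iff of_nat_numeral)
  \<comment> \<open>For \<open>t \<ge> 2\<close> the radicand is at least 9, which gives
    \<open>r \<ge> 2\<close>.\<close>
  have "sqrt 9 \<le> sqrt (8 * real t - 7)" using t by (intro real_sqrt_le_mono) auto
  moreover have "sqrt 9 = (3::real)" by (rule real_sqrt_unique) auto
  ultimately have r2: "2 \<le> r" using rt by simp
  have "2 * (r choose 2) = r * r - r" unfolding two_mult_choose_two by (simp add: diff_mult_distrib2)
  then have rc: "Suc (r choose 2) = t" using rr t by linarith
  show "(t \<le> (n - 2) choose 2 \<longrightarrow>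
          lambda1 \<Gamma> \<le> lambda1 (Gamma_sn r n) \<and>
          (lambda1 \<Gamma> = lambda1 (Gamma_sn r n) \<longleftrightarrow> \<Gamma> \<sim>\<^sub>s Gamma_sn r n)) \<and>
       (t \<ge> ((n - 2) choose 2) + 1 \<longrightarrow>
          lambda1 \<Gamma> \<le> lambda1 (Gamma_sn (n - 2) n) \<and>
          (lambda1 \<Gamma> = lambda1 (Gamma_sn (n - 2) n) \<longleftrightarrow> \<Gamma> \<sim>\<^sub>s Gamma_sn (n - 2) n))"
  proof (intro conjI[of "_ \<longrightarrow> _"] impI)
    assume "t \<le> (n - 2) choose 2"
    then have lt: "r choose 2 < (n - 2) choose 2" using rc by simp
    have "r + 2 \<le> n"
    proof (rule ccontr)
      assume "\<not> r + 2 \<le> n"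
      then have "(n - 2) choose 2 \<le> r choose 2" by (intro binomial_right_mono) simp
      then show False using lt by simp
    qed
    then show "lambda1 \<Gamma> \<le> lambda1 (Gamma_sn r n) \<and>
        (lambda1 \<Gamma> = lambda1 (Gamma_sn r n) \<longleftrightarrow> \<Gamma> \<sim>\<^sub>s Gamma_sn r n)"
      using bound r2 free rc by simp
  next
    show "lambda1 \<Gamma> \<le> lambda1 (Gamma_sn (n - 2) n) \<and>
        (lambda1 \<Gamma> = lambda1 (Gamma_sn (n - 2) n) \<longleftrightarrow> \<Gamma> \<sim>\<^sub>s Gamma_sn (n - 2) n)"
      using bound[of "n - 2"] n by simp
  qed
qed

end
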